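(* Let $(\mathbb{X},\mathbb{U},\mathcal{T},c)$ be a Markov decision process with $\mathbb{X}\subset\mathbb{R}^n$ Borel and discount factor $\beta\in(0,1)$, such that: (A1) $\mathbb{U}$ is compact (and finite); $c:\mathbb{X}\times\mathbb{U}\to\mathbb{R}$ is nonnegative, bounded and continuous; $\mathcal{T}$ is weak Feller, i.e. $(x,u)\mapsto\int g(x_1)\,\mathcal{T}(dx_1|x,u)$ is continuous for every bounded continuous $g:\mathbb{X}\to\mathbb{R}$; (A2) there are constants $\alpha_c,\alpha_T>0$ such that for all $x,x'\in\mathbb{X}$, $u\in\mathbb{U}$: $|c(x,u)-c(x',u)|\le\alpha_c\|x-x'\|_1$ and $\|\mathcal{T}(\cdot|x,u)-\mathcal{T}(\cdot|x',u)\|_{TV}\le\alpha_T\|x-x'\|_1$. Let $\{B_i\}_{i=1}^M$ be a measurable partition of $\mathbb{X}$, let $\pi$ be a probability measure on $\mathbb{X}$ with $\pi(B_i)>0$ for all $i$, and let $\hat J_\beta$ be the value function of the associated finite model and $L$ the associated loss function (both defined in the context). Then for any initial state $x_0\in\mathbb{X}$, $$\left|\hat J_\beta(x_0)-J^*_\beta(x_0)\right|\le\left(\alpha_c+\frac{\beta\alpha_T\|c\|_\infty}{1-\beta}\right)\mathbb{E}^{\gamma_s}_{x_0}\left[\sum_{t=0}^\infty\beta^tL(X_t)\right],$$ where $\gamma_s$ is the stationary policy which at each state $x$ applies an action achieving the supremum in $\sup_{u\in\mathbb{U}}\int|\hat J_\beta(x_1)-J^*_\beta(x_1)|\,\mathcal{T}(dx_1|x,u)$.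 In particular, $$\left|\hat J_\beta(x_0)-J^*_\beta(x_0)\right|\le\left(\alpha_c+\frac{\beta\alpha_T\|c\|_\infty}{1-\beta}\right)\sup_{\gamma_s\in\Gamma_s}\mathbb{E}^{\gamma_s}_{x_0}\left[\sum_{t=0}^\infty\beta^tL(X_t)\right],$$ where $\Gamma_s$ is the set of stationary policies.
   Context: MDP: $\mathcal{T}(\cdot|x,u)$ is a stochastic kernel from $\mathbb{X}\times\mathbb{U}$ to $\mathbb{X}$. An admissible policy $\gamma=\{\gamma_t\}$ chooses $U_t=\gamma_t(X_0,\dots,X_t,U_0,\dots,U_{t-1})$ measurably; $\Gamma$ is the set of admissible policies. A stationary policy is given by a measurable $f:\mathbb{X}\to\mathbb{U}$ with $U_t=f(X_t)$ for all $t$. $\mathbb{E}^{\gamma}_{x_0}$ is the expectation for the process started at $X_0=x_0$ under policy $\gamma$ and kernel $\mathcal{T}$. $J_\beta(x_0,\gamma)=\mathbb{E}^\gamma_{x_0}[\sum_{t\ge0}\beta^tc(X_t,U_t)]$ and $J_\beta^*(x_0)=\inf_{\gamma\in\Gamma}J_\beta(x_0,\gamma)$. Finite model: each bin $B_i$ has a representative $y_i\in B_i$; $\mathbb{Y}=\{y_1,\dots,y_M\}$; $q(x)=y_i$ for $x\in B_i$. The weighting measures are $\hat\pi_{y_i}(A)=\pi(A)/\pi(B_i)$ for measurable $A\subseteq B_i$. Set $C^*(y_i,u)=\int_{B_i}c(x,u)\,\hat\pi_{y_i}(dx)$ and $P^*(y_j|y_i,u)=\int_{B_i}\mathcal{T}(B_j|x,u)\,\hat\pi_{y_i}(dx)$.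 $\hat J_\beta:\mathbb{Y}\to\mathbb{R}$ is the solution of $\hat J_\beta(y)=\inf_{u\in\mathbb{U}}\{C^*(y,u)+\beta\sum_{z\in\mathbb{Y}}\hat J_\beta(z)P^*(z|y,u)\}$, extended to $\mathbb{X}$ by $\hat J_\beta(x)=\hat J_\beta(q(x))$. Loss function: $L(x)=\int_{B_i}\|x-x'\|_1\,\hat\pi_{y_i}(dx')$ for $x\in B_i$ (values in $[0,\infty]$), where $\|\cdot\|_1$ is the $\ell_1$ norm on $\mathbb{R}^n$. Total variation convention: $\|\mu-\nu\|_{TV}=\sup_{\|f\|_\infty\le1}|\int f\,d\mu-\int f\,d\nu|$. Right-hand sides may be $+\infty$. *)

theory Defs
  imports "HOL-Probability.Probability"
begin

section \<open>Norms\<close>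

definition l1_norm :: "real ^ 'n \<Rightarrow> real" where
  "l1_norm x = (\<Sum>i\<in>UNIV. \<bar>x $ i\<bar>)"

text \<open>The convention without the factor 1/2; both measures are meant to live on the same
  measurable space. For probability measures the supremum is at most 2, so the real-valued
  supremum is a genuine one.\<close>

definition tv_dist :: "'a measure \<Rightarrow> 'a measure \<Rightarrow> real" where
  "tv_dist \<mu> \<nu> =
    (SUP f\<in>{f \<in> borel_measurable \<mu>. \<forall>x\<in>space \<mu>. \<bar>f x\<bar> \<le> 1}.
      \<bar>(\<integral>x. f x \<partial>\<mu>) - (\<integral>x. f x \<partial>\<nu>)\<bar>)"

definition sup_norm_on :: "'a set \<Rightarrow> ('a \<Rightarrow> real) \<Rightarrow> real" where
  "sup_norm_on S f = (SUP z\<in>S. \<bar>f z\<bar>)"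


section \<open>Markov decision processes\<close>

abbreviation borel_on :: "'a::topological_space set \<Rightarrow> 'a measure" where
  "borel_on S \<equiv> restrict_space borel S"

type_synonym ('x, 'u) policy = "nat \<Rightarrow> (nat \<Rightarrow> 'x) \<times> (nat \<Rightarrow> 'u) \<Rightarrow> 'u"

definition weak_feller ::
  "'x::topological_space set \<Rightarrow> 'u::topological_space set \<Rightarrow> ('x \<times> 'u \<Rightarrow> 'x measure) \<Rightarrow> bool" where
  "weak_feller X U T \<longleftrightarrow>
    (\<forall>g :: 'x \<Rightarrow> real. continuous_on X g \<and> bounded (g ` X) \<longrightarrow>
      continuous_on (X \<times> U) (\<lambda>z. \<integral>x'. g x' \<partial>T z))"

text \<open>The action at time \<open>t\<close> is a measurable function of the states \<open>X\<^sub>0, \<dots>, X\<^sub>t\<close> and of the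
  actions \<open>U\<^sub>0, \<dots>, U\<^sub>t\<^sub>-\<^sub>1\<close>.\<close>

definition admissible ::
  "'x::topological_space set \<Rightarrow> 'u::topological_space set \<Rightarrow> ('x, 'u) policy set" where
  "admissible X U =
    {\<gamma>. \<forall>t. \<gamma> t \<in> (PiM {..t} (\<lambda>_. borel_on X)) \<Otimes>\<^sub>M (PiM {..<t} (\<lambda>_. borel_on U)) \<rightarrow>\<^sub>M borel_on U}"

definition stationary :: "('x \<Rightarrow> 'u) \<Rightarrow> ('x, 'u) policy" where
  "stationary f = (\<lambda>t (xs, us). f (xs t))"

text \<open>The law of \<open>(X\<^sub>n, U\<^sub>n)\<close> given \<open>\<omega> i = (X\<^sub>i, U\<^sub>i)\<close> for \<open>i < n\<close>.\<close>

definition mdp_step ::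
  "'x::topological_space set \<Rightarrow> 'u::topological_space set \<Rightarrow> ('x \<times> 'u \<Rightarrow> 'x measure) \<Rightarrow>
    ('x, 'u) policy \<Rightarrow> 'x \<Rightarrow> nat \<Rightarrow> (nat \<Rightarrow> 'x \<times> 'u) \<Rightarrow> ('x \<times> 'u) measure" where
  "mdp_step X U T \<gamma> x\<^sub>0 n \<omega> =
    distr (if n = 0 then return (borel_on X) x\<^sub>0 else T (\<omega> (n - 1)))
      (borel_on X \<Otimes>\<^sub>M borel_on U)
      (\<lambda>x. (x, \<gamma> n (\<lambda>i\<in>{..n}. if i = n then x else fst (\<omega> i), \<lambda>i\<in>{..<n}. snd (\<omega> i))))"

lemma Ionescu_Tulcea_mdp_step:
  fixes X :: "'x::topological_space set" and U :: "'u::topological_space set"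
  assumes T[measurable]: "T \<in> borel_on X \<Otimes>\<^sub>M borel_on U \<rightarrow>\<^sub>M prob_algebra (borel_on X)"
    and \<gamma>: "\<gamma> \<in> admissible X U" and x0: "x\<^sub>0 \<in> X"
  shows "Ionescu_Tulcea (mdp_step X U T \<gamma> x\<^sub>0) (\<lambda>_. borel_on X \<Otimes>\<^sub>M borel_on U)"
proof -
  let ?S = "borel_on X \<Otimes>\<^sub>M borel_on U"
  have g[measurable]: "\<gamma> t \<in> (PiM {..t} (\<lambda>_. borel_on X)) \<Otimes>\<^sub>M (PiM {..<t} (\<lambda>_. borel_on U)) \<rightarrow>\<^sub>M borel_on U" for t
    using \<gamma> by (auto simp: admissible_def)
  have x0': "x\<^sub>0 \<in> space (borel_on X)" using x0 by (simp add: space_restrict_space)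
  have K: "mdp_step X U T \<gamma> x\<^sub>0 n \<in> PiM {0..<n} (\<lambda>_. ?S) \<rightarrow>\<^sub>M prob_algebra ?S" for n
  proof -
    let ?P = "PiM {0..<n} (\<lambda>_. ?S)"
    have "n - 1 \<in> {0..<n}" if "n \<noteq> 0" using that by auto
    then have 1: "(\<lambda>\<omega>. if n = 0 then return (borel_on X) x\<^sub>0 else T (\<omega> (n - 1))) \<in> ?P \<rightarrow>\<^sub>M prob_algebra (borel_on X)"
      using x0' by (cases "n = 0") (auto intro!: measurable_compose[OF _ T] measurable_component_singleton
          measurable_compose[OF _ measurable_return_prob_space])
    have c1: "(\<lambda>p. if i = n then snd p else fst (fst p i)) \<in> ?P \<Otimes>\<^sub>M borel_on X \<rightarrow>\<^sub>M borel_on X" if "i \<in> {..n}" for i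
    proof (cases "i = n")
      case False
      then have "i \<in> {0..<n}" using that by auto
      then have "(\<lambda>p. fst p i) \<in> ?P \<Otimes>\<^sub>M borel_on X \<rightarrow>\<^sub>M ?S"
        by (intro measurable_compose[OF measurable_fst] measurable_component_singleton)
      then show ?thesis using False by (auto intro: measurable_compose[OF _ measurable_fst])
    qed auto
    have c2: "(\<lambda>p. snd (fst p i)) \<in> ?P \<Otimes>\<^sub>M borel_on X \<rightarrow>\<^sub>M borel_on U" if "i \<in> {..<n}" for i
    proof -
      have "i \<in> {0..<n}" using that by auto
      then have "(\<lambda>p. fst p i) \<in> ?P \<Otimes>\<^sub>M borel_on X \<rightarrow>\<^sub>M ?S"
        by (intro measurable_compose[OF measurable_fst] measurable_component_singleton)
      then show ?thesis by (auto intro: measurable_compose[OF _ measurable_snd])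
    qed
    have 2: "(\<lambda>(\<omega>, x). (x, \<gamma> n (\<lambda>i\<in>{..n}. if i = n then x else fst (\<omega> i), \<lambda>i\<in>{..<n}. snd (\<omega> i))))
       \<in> ?P \<Otimes>\<^sub>M borel_on X \<rightarrow>\<^sub>M ?S"
      unfolding split_beta
      by (intro measurable_Pair measurable_snd measurable_compose[OF _ g] measurable_restrict c1 c2)
    show ?thesis
      using measurable_distr_prob_space2[OF 1 2] unfolding mdp_step_def .
  qed
  show ?thesis
    unfolding Ionescu_Tulcea_def
    using measurable_prob_algebraD[OF K] measurable_space[OF K] by (auto simp: space_prob_algebra)
qed

text \<open>The Ionescu-Tulcea measure on state-action trajectories.\<close>

definition mdp_measure ::
  "'x::topological_space set \<Rightarrow> 'u::topological_space set \<Rightarrow> ('x \<times> 'u \<Rightarrow> 'x measure) \<Rightarrow>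
    ('x, 'u) policy \<Rightarrow> 'x \<Rightarrow> (nat \<Rightarrow> 'x \<times> 'u) measure" where
  "mdp_measure X U T \<gamma> x\<^sub>0 =
    (let M = (\<lambda>_. borel_on X \<Otimes>\<^sub>M borel_on U)
     in projective_family.lim UNIV (Ionescu_Tulcea.CI (mdp_step X U T \<gamma> x\<^sub>0) M) M)"

definition discounted_cost ::
  "'x::topological_space set \<Rightarrow> 'u::topological_space set \<Rightarrow> ('x \<times> 'u \<Rightarrow> 'x measure) \<Rightarrow>
    ('x \<times> 'u \<Rightarrow> real) \<Rightarrow> real \<Rightarrow> 'x \<Rightarrow> ('x, 'u) policy \<Rightarrow> real" where
  "discounted_cost X U T c \<beta> x\<^sub>0 \<gamma> =
    (\<integral>\<omega>. (\<Sum>t. \<beta> ^ t * c (\<omega> t)) \<partial>mdp_measure X U T \<gamma> x\<^sub>0)"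

definition optimal_cost ::
  "'x::topological_space set \<Rightarrow> 'u::topological_space set \<Rightarrow> ('x \<times> 'u \<Rightarrow> 'x measure) \<Rightarrow>
    ('x \<times> 'u \<Rightarrow> real) \<Rightarrow> real \<Rightarrow> 'x \<Rightarrow> real" where
  "optimal_cost X U T c \<beta> x\<^sub>0 = (INF \<gamma>\<in>admissible X U. discounted_cost X U T c \<beta> x\<^sub>0 \<gamma>)"

definition expected_discounted ::
  "'x::topological_space set \<Rightarrow> 'u::topological_space set \<Rightarrow> ('x \<times> 'u \<Rightarrow> 'x measure) \<Rightarrow>
    ('x \<Rightarrow> ennreal) \<Rightarrow> real \<Rightarrow> 'x \<Rightarrow> ('x, 'u) policy \<Rightarrow> ennreal" where
  "expected_discounted X U T h \<beta> x\<^sub>0 \<gamma> =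
    (\<integral>\<^sup>+\<omega>. (\<Sum>t. ennreal (\<beta> ^ t) * h (fst (\<omega> t))) \<partial>mdp_measure X U T \<gamma> x\<^sub>0)"


section \<open>The finite model\<close>

text \<open>The bins are \<open>B 1, \<dots>, B M\<close>, with representatives \<open>y 1, \<dots>, y M\<close>.\<close>

definition bin_index :: "(nat \<Rightarrow> 'x set) \<Rightarrow> nat \<Rightarrow> 'x \<Rightarrow> nat" where
  "bin_index B M x = (THE i. i \<in> {1..M} \<and> x \<in> B i)"

definition bin :: "(nat \<Rightarrow> 'x set) \<Rightarrow> nat \<Rightarrow> 'x \<Rightarrow> 'x set" where
  "bin B M x = B (bin_index B M x)"

definition quantize :: "(nat \<Rightarrow> 'x set) \<Rightarrow> nat \<Rightarrow> (nat \<Rightarrow> 'x) \<Rightarrow> 'x \<Rightarrow> 'x" where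
  "quantize B M y x = y (bin_index B M x)"

text \<open>The normalised restriction of \<open>\<pi>\<close> to the bin of \<open>x\<close>, as a measure on the whole state space.
  It vanishes outside the bin, so integrals over the bin are written as integrals over the space.\<close>

definition bin_weight :: "(nat \<Rightarrow> 'x set) \<Rightarrow> nat \<Rightarrow> 'x measure \<Rightarrow> 'x \<Rightarrow> 'x measure" where
  "bin_weight B M \<pi> x = uniform_measure \<pi> (bin B M x)"

definition finite_cost ::
  "(nat \<Rightarrow> 'x set) \<Rightarrow> nat \<Rightarrow> 'x measure \<Rightarrow> ('x \<times> 'u \<Rightarrow> real) \<Rightarrow> 'x \<Rightarrow> 'u \<Rightarrow> real" where
  "finite_cost B M \<pi> c y u = (\<integral>x. c (x, u) \<partial>bin_weight B M \<pi> y)"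

definition finite_kernel ::
  "(nat \<Rightarrow> 'x set) \<Rightarrow> nat \<Rightarrow> 'x measure \<Rightarrow> ('x \<times> 'u \<Rightarrow> 'x measure) \<Rightarrow> 'x \<Rightarrow> 'x \<Rightarrow> 'u \<Rightarrow> real" where
  "finite_kernel B M \<pi> T z y u = (\<integral>x. measure (T (x, u)) (bin B M z) \<partial>bin_weight B M \<pi> y)"

text \<open>The unique solution, on \<open>Y = y ` {1..M}\<close>, of the optimality equation of the finite model.
  Extensionality only fixes the irrelevant values outside \<open>Y\<close>.\<close>

definition finite_value ::
  "(nat \<Rightarrow> 'x set) \<Rightarrow> nat \<Rightarrow> (nat \<Rightarrow> 'x) \<Rightarrow> 'x measure \<Rightarrow> 'u set \<Rightarrow> ('x \<times> 'u \<Rightarrow> 'x measure) \<Rightarrow>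
    ('x \<times> 'u \<Rightarrow> real) \<Rightarrow> real \<Rightarrow> 'x \<Rightarrow> real" where
  "finite_value B M y \<pi> U T c \<beta> =
    (THE J. J \<in> extensional (y ` {1..M}) \<and>
      (\<forall>v\<in>y ` {1..M}. J v =
        (INF u\<in>U. finite_cost B M \<pi> c v u
          + \<beta> * (\<Sum>z\<in>y ` {1..M}. J z * finite_kernel B M \<pi> T z v u))))"

definition finite_value_ext ::
  "(nat \<Rightarrow> 'x set) \<Rightarrow> nat \<Rightarrow> (nat \<Rightarrow> 'x) \<Rightarrow> 'x measure \<Rightarrow> 'u set \<Rightarrow> ('x \<times> 'u \<Rightarrow> 'x measure) \<Rightarrow>
    ('x \<times> 'u \<Rightarrow> real) \<Rightarrow> real \<Rightarrow> 'x \<Rightarrow> real" where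
  "finite_value_ext B M y \<pi> U T c \<beta> x = finite_value B M y \<pi> U T c \<beta> (quantize B M y x)"

definition quant_loss :: "(nat \<Rightarrow> (real ^ 'n) set) \<Rightarrow> nat \<Rightarrow> (real ^ 'n) measure \<Rightarrow> real ^ 'n \<Rightarrow> ennreal" where
  "quant_loss B M \<pi> x = (\<integral>\<^sup>+x'. ennreal (l1_norm (x - x')) \<partial>bin_weight B M \<pi> x)"

text \<open>\<open>f\<close> is a stationary policy whose action in each state attains
  \<open>sup\<^sub>u \<integral> \<bar>J\<^sub>1 - J\<^sub>2\<bar> dT(x, u)\<close>.\<close>

definition error_maximizing ::
  "'x::topological_space set \<Rightarrow> 'u::topological_space set \<Rightarrow> ('x \<times> 'u \<Rightarrow> 'x measure) \<Rightarrow>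
    ('x \<Rightarrow> real) \<Rightarrow> ('x \<Rightarrow> real) \<Rightarrow> ('x \<Rightarrow> 'u) \<Rightarrow> bool" where
  "error_maximizing X U T J\<^sub>1 J\<^sub>2 f \<longleftrightarrow>
    f \<in> borel_on X \<rightarrow>\<^sub>M borel_on U \<and>
    (\<forall>x\<in>X. (\<integral>x'. \<bar>J\<^sub>1 x' - J\<^sub>2 x'\<bar> \<partial>T (x, f x)) = (SUP u\<in>U. \<integral>x'. \<bar>J\<^sub>1 x' - J\<^sub>2 x'\<bar> \<partial>T (x, u)))"

end

theory Submission
  imports Defs
begin

text \<open>The optimal cost is the bounded measurable fixed point of the Bellman operator, by telescoping
  the Bellman (in)equality along trajectories. The finite model's value, extended by
  \<open>x \<mapsto> q(x)\<close>, solves \<open>J x = inf\<^sub>u \<integral> (c(x', u) + \<beta> \<integral> J dT(x', u)) d\<pi>\<^sub>x(x')\<close> with \<open>\<pi>\<^sub>x\<close> the weighting measure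
  of the bin of \<open>x\<close>. Moving \<open>x'\<close> to \<open>x\<close> costs at most
  \<open>(\<alpha>\<^sub>c + \<beta> \<alpha>\<^sub>T \<parallel>J\<parallel>) L(x)\<close> with \<open>\<parallel>J\<parallel> \<le> \<parallel>c\<parallel> / (1 - \<beta>)\<close>, so the error \<open>D\<close> satisfies
  \<open>D x \<le> K L(x) + \<beta> sup\<^sub>u \<integral> D dT(x, u)\<close>; iterating this along the error-maximizing policy, the
  remainder \<open>\<beta>\<^sup>n E[D(X\<^sub>n)]\<close> vanishes because \<open>D\<close> is bounded.\<close>

section \<open>Ionescu-Tulcea marginals\<close>

text \<open>\<open>Jhat\<close> is constant on bins, hence usually discontinuous, so no modulus of
  continuity of it can carry \<open>x'\<close> to \<open>x\<close>. The regularity is taken from the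
  kernel instead: a total variation bound moves the integral of any function bounded by
  \<open>R\<close>, which is the origin of the term \<open>\<alpha>\<^sub>T * R\<close>, and
  \<open>R = C / (1 - \<beta>)\<close> solves \<open>C + \<beta> * R = R\<close>. Comparing two
  infima over actions calls for a bound valid at every action; this is why the iteration follows the
  policy that is worst for the error and not an optimal one. \<open>L\<close> may be infinite, so
  the iterations run in \<open>ennreal\<close> and never subtract. Policies may depend on the whole
  history, yet only laws of single coordinates enter: the mean of \<open>h\<close> at the state of
  time \<open>n + 1\<close> is the mean of its integral against \<open>T (\<omega> n)\<close>,
  whatever the policy. \<open>optimal_cost\<close> is a bare infimum over policies, and its
  measurability comes from the identification with a fixed point; the finite action set supplies
  measurable selectors.\<close>

context Ionescu_Tulcea
begin

text \<open>Makes the marginals on initial segments accessible as iterated kernels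
  \<open>C 0 n\<close>, which unfold one kernel at a time. The start
  \<open>\<lambda>_. undefined\<close> is the only point of the product over the empty index
  set.\<close>

lemma CI_initial: "CI {0..<n} = C 0 n (\<lambda>_. undefined)"
proof (rule measure_eqI)
  show "sets (CI {0..<n}) = sets (C 0 n (\<lambda>_. undefined))"
    by (simp add: CI_def sets_C space_PiM)
next
  fix A assume "A \<in> sets (CI {0..<n})"
  then have A: "A \<in> sets (PiM {0..<n} M)" by (simp add: CI_def)
  then show "emeasure (CI {0..<n}) A = emeasure (C 0 n (\<lambda>_. undefined)) A"
    using emeasure_CI[OF subset_refl A] prod_emb_id[of A "{0..<n}" M] sets.sets_into_space[OF A]
    by (simp add: space_PiM)
qed

lemma measurable_restrict_lim: "(\<lambda>\<omega>. restrict \<omega> J) \<in> PF.lim \<rightarrow>\<^sub>M PiM J M"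
  by (subst measurable_cong_sets[OF PF.sets_lim refl]) (rule measurable_restrict_subset, simp)

lemma nn_integral_lim_initial:
  assumes "f \<in> borel_measurable (PiM {0..<n} M)"
  shows "(\<integral>\<^sup>+\<omega>. f (restrict \<omega> {0..<n}) \<partial>PF.lim) = (\<integral>\<^sup>+\<omega>. f \<omega> \<partial>C 0 n (\<lambda>_. undefined))"
  using assms by (simp flip: CI_initial distr_lim add: nn_integral_distr measurable_restrict_lim)

text \<open>Both sides depend on finitely many coordinates, so they can be computed under
  \<open>C 0 (Suc n)\<close> and \<open>C 0 n\<close>; the former is the latter bound with the
  extended kernel \<open>eP n\<close>. The restriction is there because \<open>P n\<close> is a
  kernel on the first \<open>n\<close> coordinates only.\<close>

lemma nn_integral_lim_component:
  assumes h[measurable]: "h \<in> borel_measurable (M n)"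
  shows "(\<integral>\<^sup>+\<omega>. h (\<omega> n) \<partial>PF.lim) = (\<integral>\<^sup>+\<omega>. (\<integral>\<^sup>+z. h z \<partial>P n (restrict \<omega> {0..<n})) \<partial>PF.lim)"
proof -
  have m: "(\<lambda>\<omega>. h (\<omega> n)) \<in> borel_measurable (PiM {0..<Suc n} M)" by measurable
  have P': "(\<lambda>\<omega>. \<integral>\<^sup>+z. h z \<partial>P n \<omega>) \<in> borel_measurable (PiM {0..<n} M)"
    by (rule measurable_compose[OF P nn_integral_measurable_subprob_algebra[OF h]])
  have "(\<integral>\<^sup>+\<omega>. h (\<omega> n) \<partial>PF.lim) = (\<integral>\<^sup>+\<omega>. h (\<omega> n) \<partial>C 0 (Suc n) (\<lambda>_. undefined))"
    using nn_integral_lim_initial[OF m] by simp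
  also have "\<dots> = (\<integral>\<^sup>+\<omega>. (\<integral>\<^sup>+\<omega>'. h (\<omega>' n) \<partial>eP n \<omega>) \<partial>C 0 n (\<lambda>_. undefined))"
    using m measurable_eP[of n]
    by (simp add: nn_integral_bind[where B="PiM {0..<Suc n} M"] measurable_cong_sets[OF sets_C refl] space_PiM)
  also have "\<dots> = (\<integral>\<^sup>+\<omega>. (\<integral>\<^sup>+z. h z \<partial>P n \<omega>) \<partial>C 0 n (\<lambda>_. undefined))"
    using nn_integral_eP[OF _ m] by (auto intro!: nn_integral_cong simp: space_C space_PiM)
  also have "\<dots> = (\<integral>\<^sup>+\<omega>. (\<integral>\<^sup>+z. h z \<partial>P n (restrict \<omega> {0..<n})) \<partial>PF.lim)"
    using nn_integral_lim_initial[OF P'] by simp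
  finally show ?thesis .
qed

text \<open>A pushforward keeps the total mass, so it is enough to look at the marginal on the empty
  index set.\<close>

lemma prob_space_lim: "prob_space PF.lim"
proof -
  have "prob_space (distr PF.lim (PiM {} M) (\<lambda>\<omega>. restrict \<omega> {}))"
    by (subst distr_lim) (auto intro: PF.prob_space_P)
  then show ?thesis
    by (rule prob_space_distrD[rotated]) (rule measurable_restrict_lim)
qed

end

section \<open>Recursions, fixed points and selection\<close>

text \<open>Unrolling the inequality \<open>n\<close> times leaves the remainder
  \<open>\<beta> ^ n * a n\<close>, which tends to 0 by the uniform bound. The terms
  \<open>b n\<close> may be infinite.\<close>

lemma discounted_recursion_bound:
  fixes a b :: "nat \<Rightarrow> ennreal" and \<beta> R :: real
  assumes \<beta>: "0 \<le> \<beta>" "\<beta> < 1"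
    and step: "\<And>n. a n \<le> b n + ennreal \<beta> * a (Suc n)" and bound: "\<And>n. a n \<le> ennreal R"
  shows "a 0 \<le> (\<Sum>n. ennreal (\<beta> ^ n) * b n)"
proof -
  have partial: "a 0 \<le> (\<Sum>i<n. ennreal (\<beta> ^ i) * b i) + ennreal (\<beta> ^ n) * a n" for n
  proof (induction n)
    case (Suc n)
    have "ennreal (\<beta> ^ n) * a n \<le> ennreal (\<beta> ^ n) * (b n + ennreal \<beta> * a (Suc n))"
      by (intro mult_left_mono step) simp
    also have "\<dots> = ennreal (\<beta> ^ n) * b n + ennreal (\<beta> ^ Suc n) * a (Suc n)"
      using \<beta> by (simp add: distrib_left ennreal_mult mult_ac)
    finally have "ennreal (\<beta> ^ n) * a n \<le> ennreal (\<beta> ^ n) * b n + ennreal (\<beta> ^ Suc n) * a (Suc n)" .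
    from order_trans[OF Suc add_left_mono[OF this]]
    show ?case by (simp only: sum.lessThan_Suc add.assoc)
  qed simp
  let ?s = "\<Sum>n. ennreal (\<beta> ^ n) * b n"
  \<comment> \<open>\<open>R\<close> may be negative, where \<open>ennreal R\<close> is 0;
    \<open>max R 0\<close> makes \<open>ennreal\<close> multiplicative here.\<close>
  have "a 0 \<le> ?s + ennreal (\<beta> ^ n * max R 0)" for n
  proof -
    have "a n \<le> ennreal (max R 0)" using bound[of n] by (auto intro: order_trans ennreal_leI)
    then have "ennreal (\<beta> ^ n) * a n \<le> ennreal (\<beta> ^ n * max R 0)"
      using \<beta> by (simp add: ennreal_mult mult_left_mono)
    then show ?thesis
      using partial[of n] sum_le_suminf[of "\<lambda>n. ennreal (\<beta> ^ n) * b n" "{..<n}"]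
      by (auto intro: order_trans add_mono)
  qed
  moreover have "(\<lambda>n. ?s + ennreal (\<beta> ^ n * max R 0)) \<longlonglongrightarrow> ?s + ennreal (0 * max R 0)"
    using \<beta> by (intro tendsto_intros tendsto_ennrealI LIMSEQ_power_zero) auto
  ultimately show ?thesis
    by (intro LIMSEQ_le_const[of _ ?s]) auto
qed

text \<open>In this direction the remainder \<open>\<beta> ^ n * a n\<close> is nonnegative and is
  dropped.\<close>

lemma discounted_recursion_ge:
  fixes a b :: "nat \<Rightarrow> ennreal" and \<beta> :: real
  assumes \<beta>: "0 \<le> \<beta>" and step: "\<And>n. b n + ennreal \<beta> * a (Suc n) \<le> a n"
  shows "(\<Sum>n. ennreal (\<beta> ^ n) * b n) \<le> a 0"
proof -
  have partial: "(\<Sum>i<n. ennreal (\<beta> ^ i) * b i) + ennreal (\<beta> ^ n) * a n \<le> a 0" for n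
  proof (induction n)
    case (Suc n)
    have "ennreal (\<beta> ^ n) * b n + ennreal (\<beta> ^ Suc n) * a (Suc n) = ennreal (\<beta> ^ n) * (b n + ennreal \<beta> * a (Suc n))"
      using \<beta> by (simp add: distrib_left ennreal_mult mult_ac)
    also have "\<dots> \<le> ennreal (\<beta> ^ n) * a n"
      by (intro mult_left_mono step) simp
    finally have "ennreal (\<beta> ^ n) * b n + ennreal (\<beta> ^ Suc n) * a (Suc n) \<le> ennreal (\<beta> ^ n) * a n" .
    from order_trans[OF add_left_mono[OF this] Suc]
    show ?case by (simp only: sum.lessThan_Suc add.assoc)
  qed simp
  have "(\<Sum>i<n. ennreal (\<beta> ^ i) * b i) \<le> a 0" for n
    by (rule order_trans[OF _ partial[of n]]) simp
  then show ?thesis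
    by (simp add: suminf_eq_SUP SUP_le_iff)
qed

text \<open>Banach iteration for a class \<open>Q\<close> closed under pointwise limits on
  \<open>S\<close>. This form serves bounded measurable functions on \<open>X\<close> as well as
  functions on the finite set of representatives, and asks for equality on \<open>S\<close>
  only.\<close>

lemma contraction_fixpoint:
  fixes F :: "('a \<Rightarrow> real) \<Rightarrow> 'a \<Rightarrow> real"
  assumes \<beta>: "0 \<le> \<beta>" "\<beta> < 1"
    and init: "Q v\<^sub>0" and Q_F: "\<And>v. Q v \<Longrightarrow> Q (F v)"
    and bound: "\<And>v x. Q v \<Longrightarrow> x \<in> S \<Longrightarrow> \<bar>v x\<bar> \<le> R"
    and Q_lim: "\<And>V v. (\<And>n. Q (V n)) \<Longrightarrow> (\<And>x. x \<in> S \<Longrightarrow> (\<lambda>n. V n x) \<longlonglongrightarrow> v x) \<Longrightarrow> Q v"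
    and contr: "\<And>v w e x. Q v \<Longrightarrow> Q w \<Longrightarrow> (\<And>x. x \<in> S \<Longrightarrow> \<bar>v x - w x\<bar> \<le> e) \<Longrightarrow> x \<in> S \<Longrightarrow>
      \<bar>F v x - F w x\<bar> \<le> \<beta> * e"
  obtains v where "Q v" "\<And>x. x \<in> S \<Longrightarrow> v x = F v x"
proof -
  define V where "V n = (F ^^ n) v\<^sub>0" for n
  have V_Suc: "V (Suc n) = F (V n)" for n by (simp add: V_def)
  have QV: "Q (V n)" for n by (induction n) (auto simp: V_def init Q_F)
  \<comment> \<open>At \<open>n = 0\<close> two functions of the class differ by at most
    \<open>2 * R\<close>; each application of \<open>F\<close> gains a factor
    \<open>\<beta>\<close>, uniformly in \<open>k\<close>.\<close>
  have dist: "\<bar>V (n + k) x - V n x\<bar> \<le> \<beta> ^ n * (2 * R)" if "x \<in> S" for n k x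
    using that
  proof (induction n arbitrary: x)
    case 0
    then show ?case using bound[OF QV[of k], of x] bound[OF QV[of 0], of x] by simp
  next
    case (Suc n)
    then show ?case using contr[OF QV QV Suc.IH] by (simp add: V_Suc mult.assoc)
  qed
  have null: "(\<lambda>n. \<beta> ^ n * (2 * R)) \<longlonglongrightarrow> 0"
    using \<beta> by (intro tendsto_mult_left_zero LIMSEQ_power_zero) auto
  have "\<exists>l. (\<lambda>n. V n x) \<longlonglongrightarrow> l" if x: "x \<in> S" for x
  proof -
    have "Cauchy (\<lambda>n. V n x)"
    proof (rule metric_CauchyI)
      fix e :: real assume "0 < e"
      with null have "\<forall>\<^sub>F n in sequentially. \<beta> ^ n * (2 * R) < e / 2"
        by (intro order_tendstoD) auto
      then obtain N where N: "\<beta> ^ N * (2 * R) < e / 2"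
        by (auto simp: eventually_sequentially)
      have *: "\<bar>V m x - V N x\<bar> < e / 2" if "N \<le> m" for m
        using dist[OF x, of N "m - N"] N that by simp
      then have "dist (V m x) (V n x) < e" if "N \<le> m" "N \<le> n" for m n
        using *[OF that(1)] *[OF that(2)] unfolding dist_real_def by arith
      then show "\<exists>N. \<forall>m\<ge>N. \<forall>n\<ge>N. dist (V m x) (V n x) < e" by blast
    qed
    then show ?thesis by (simp add: Cauchy_convergent_iff convergent_def)
  qed
  then obtain v where v: "\<And>x. x \<in> S \<Longrightarrow> (\<lambda>n. V n x) \<longlonglongrightarrow> v x" by metis
  have Qv: "Q v" by (rule Q_lim[OF QV v])
  \<comment> \<open>Let \<open>k\<close> tend to infinity in \<open>dist\<close>.\<close>
  have rate: "\<bar>v x - V n x\<bar> \<le> \<beta> ^ n * (2 * R)" if "x \<in> S" for n x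
  proof (rule tendsto_upperbound)
    show "(\<lambda>k. \<bar>V (k + n) x - V n x\<bar>) \<longlonglongrightarrow> \<bar>v x - V n x\<bar>"
      by (intro tendsto_intros LIMSEQ_ignore_initial_segment v that)
  qed (use dist[OF that, of n] in \<open>auto simp: add.commute\<close>)
  \<comment> \<open>The shifted iterates converge to \<open>v x\<close>, and by the contraction and
    \<open>rate\<close> also to \<open>F v x\<close>.\<close>
  have "v x = F v x" if x: "x \<in> S" for x
  proof (rule LIMSEQ_unique)
    show "(\<lambda>n. V (Suc n) x) \<longlonglongrightarrow> v x" using v[OF x] by (rule LIMSEQ_Suc)
    have "(\<lambda>n. V (Suc n) x - F v x) \<longlonglongrightarrow> 0"
    proof (rule Lim_null_comparison)
      show "\<forall>\<^sub>F n in sequentially. norm (V (Suc n) x - F v x) \<le> \<beta> * (\<beta> ^ n * (2 * R))"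
        using contr[OF QV Qv _ x] rate by (simp add: V_Suc abs_minus_commute)
      show "(\<lambda>n. \<beta> * (\<beta> ^ n * (2 * R))) \<longlonglongrightarrow> 0"
        by (rule tendsto_mult_right_zero[OF null])
    qed
    then show "(\<lambda>n. V (Suc n) x) \<longlonglongrightarrow> F v x" by (rule LIM_zero_cancel)
  qed
  with Qv show ?thesis by (rule that)
qed

text \<open>Infima are nonexpansive for the uniform distance. This makes both Bellman operators
  contract and reduces the error estimate to one fixed action.\<close>

lemma abs_INF_diff_le:
  fixes f g :: "'a \<Rightarrow> real"
  assumes "finite U" "U \<noteq> {}" "\<And>u. u \<in> U \<Longrightarrow> \<bar>f u - g u\<bar> \<le> e"
  shows "\<bar>(INF u\<in>U. f u) - (INF u\<in>U. g u)\<bar> \<le> e"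
proof -
  have *: "(INF u\<in>U. f u) - e \<le> (INF u\<in>U. g u)" if "\<And>u. u \<in> U \<Longrightarrow> \<bar>f u - g u\<bar> \<le> e" for f g :: "'a \<Rightarrow> real"
  proof (rule cINF_greatest[OF assms(2)])
    fix u assume u: "u \<in> U"
    have "(INF u\<in>U. f u) \<le> f u" using assms(1) u by (intro cINF_lower) auto
    with that[OF u] show "(INF u\<in>U. f u) - e \<le> g u" by linarith
  qed
  show ?thesis using *[of f g] *[of g f] assms(3) by (simp add: abs_minus_commute abs_le_iff)
qed

text \<open>Finite sets are closed in a T1 space, so every subset of \<open>U\<close> is Borel.
  Selectors built with values in \<open>count_space U\<close> thereby become admissible decision
  rules.\<close>

lemma sets_borel_on_finite:
  fixes U :: "'a::t1_space set"
  assumes "finite U"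
  shows "sets (borel_on U) = sets (count_space U)"
  using assms finite_subset[OF _ assms]
  by (auto simp: sets_restrict_space image_iff intro!: bexI[OF _ borel_closed[OF finite_imp_closed]])

text \<open>Induction over the candidate actions: the current choice is replaced by the new action
  on the measurable set where the new one does at least as well.\<close>

lemma measurable_argmax_finite:
  fixes g :: "'a \<Rightarrow> 'u \<Rightarrow> real"
  assumes "finite U" "U \<noteq> {}" and g: "\<And>u. u \<in> U \<Longrightarrow> (\<lambda>x. g x u) \<in> borel_measurable N"
  obtains f where "f \<in> N \<rightarrow>\<^sub>M count_space U" "\<And>x. x \<in> space N \<Longrightarrow> g x (f x) = (SUP u\<in>U. g x u)"
proof -
  \<comment> \<open>The target stays \<open>count_space U\<close> while \<open>W\<close> grows, so
    the measurable space does not change during the induction.\<close>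
  have "\<exists>f \<in> N \<rightarrow>\<^sub>M count_space U. (\<forall>x\<in>space N. f x \<in> W \<and> (\<forall>u\<in>W. g x u \<le> g x (f x)))"
    if "finite W" "W \<noteq> {}" "W \<subseteq> U" for W
    using that
  proof (induction rule: finite_ne_induct)
    case (singleton u)
    then show ?case by (intro bexI[of _ "\<lambda>_. u"]) auto
  next
    case (insert u W)
    then obtain f where f[measurable]: "f \<in> N \<rightarrow>\<^sub>M count_space U"
      and opt: "\<And>x. x \<in> space N \<Longrightarrow> f x \<in> W" "\<And>x v. x \<in> space N \<Longrightarrow> v \<in> W \<Longrightarrow> g x v \<le> g x (f x)"
      by (metis insert_subset)
    have [measurable]: "(\<lambda>x. g x (f x)) \<in> borel_measurable N"
      by (rule measurable_compose_countable'[OF g f countable_finite[OF \<open>finite U\<close>]])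
    have u: "u \<in> U" using insert.prems by simp
    note g[OF u, measurable]
    define f' where "f' x = (if g x (f x) \<le> g x u then u else f x)" for x
    have "f' \<in> N \<rightarrow>\<^sub>M count_space U"
      unfolding f'_def by (intro measurable_If f measurable_const) (use u in simp_all)
    moreover have "f' x \<in> insert u W" "v \<in> insert u W \<Longrightarrow> g x v \<le> g x (f' x)" if "x \<in> space N" for x v
      using opt(1)[OF that] opt(2)[OF that, of v] by (auto simp: f'_def)
    ultimately show ?case by blast
  qed
  from this[OF assms(1,2) subset_refl] obtain f where f: "f \<in> N \<rightarrow>\<^sub>M count_space U"
    and opt: "\<And>x. x \<in> space N \<Longrightarrow> f x \<in> U \<and> (\<forall>u\<in>U. g x u \<le> g x (f x))" by blast
  show ?thesis
  proof (rule that[OF f])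
    fix x assume "x \<in> space N"
    from opt[OF this] show "g x (f x) = (SUP u\<in>U. g x u)"
      by (intro cSup_eq_maximum[symmetric]) auto
  qed
qed

section \<open>Integrals of bounded functions under a probability measure\<close>

lemma (in prob_space) integrable_Icc:
  fixes f :: "'a \<Rightarrow> real"
  assumes "f \<in> borel_measurable M" "\<And>x. x \<in> space M \<Longrightarrow> a \<le> f x" "\<And>x. x \<in> space M \<Longrightarrow> f x \<le> b"
  shows "integrable M f"
  using assms by (intro integrable_const_bound[of _ "\<bar>a\<bar> + \<bar>b\<bar>"] AE_I2) fastforce+

lemma (in prob_space) integral_Icc:
  fixes f :: "'a \<Rightarrow> real"
  assumes "f \<in> borel_measurable M" "\<And>x. x \<in> space M \<Longrightarrow> a \<le> f x" "\<And>x. x \<in> space M \<Longrightarrow> f x \<le> b"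
  shows "a \<le> integral\<^sup>L M f" "integral\<^sup>L M f \<le> b"
  using integral_ge_const[OF integrable_Icc[OF assms] AE_I2, of a]
    integral_le_const[OF integrable_Icc[OF assms] AE_I2, of b] assms(2,3) by auto

lemma (in prob_space) abs_integral_diff_le:
  fixes f g :: "'a \<Rightarrow> real"
  assumes "integrable M f" "integrable M g" "\<And>x. x \<in> space M \<Longrightarrow> \<bar>f x - g x\<bar> \<le> e"
  shows "\<bar>integral\<^sup>L M f - integral\<^sup>L M g\<bar> \<le> e"
proof -
  have "\<bar>integral\<^sup>L M f - integral\<^sup>L M g\<bar> \<le> (\<integral>x. \<bar>f x - g x\<bar> \<partial>M)"
    using assms(1,2) by (simp flip: Bochner_Integration.integral_diff)
  also have "\<dots> \<le> e" using assms by (intro integral_le_const AE_I2) auto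
  finally show ?thesis .
qed

section \<open>Dynamic programming\<close>

text \<open>\<open>C\<close> stands for the sup norm of the cost. Measurability of \<open>c\<close>
  is assumed action by action; finiteness of \<open>U\<close> turns it into joint
  measurability.\<close>

locale finite_action_mdp =
  fixes X :: "'x::topological_space set" and U :: "'u::t1_space set"
    and T :: "'x \<times> 'u \<Rightarrow> 'x measure" and c :: "'x \<times> 'u \<Rightarrow> real" and \<beta> C :: real
  assumes U_finite: "finite U" and U_nonempty: "U \<noteq> {}"
    and T_kernel: "T \<in> borel_on X \<Otimes>\<^sub>M borel_on U \<rightarrow>\<^sub>M prob_algebra (borel_on X)"
    and beta: "0 < \<beta>" "\<beta> < 1"
    and c_section: "\<And>u. u \<in> U \<Longrightarrow> (\<lambda>x. c (x, u)) \<in> borel_measurable (borel_on X)"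
    and c_nonneg: "\<And>x u. x \<in> X \<Longrightarrow> u \<in> U \<Longrightarrow> 0 \<le> c (x, u)"
    and c_le: "\<And>x u. x \<in> X \<Longrightarrow> u \<in> U \<Longrightarrow> c (x, u) \<le> C"
    and C_nonneg: "0 \<le> C"
begin

text \<open>The discounted total of paying \<open>C\<close> forever, that is, the bound that one
  Bellman step reproduces.\<close>

definition "R = C / (1 - \<beta>)"

definition "value_function v \<longleftrightarrow> v \<in> borel_measurable (borel_on X) \<and> (\<forall>x\<in>X. 0 \<le> v x \<and> v x \<le> R)"

lemma R_nonneg: "0 \<le> R" using C_nonneg beta by (simp add: R_def)

lemma R_eq: "C + \<beta> * R = R" using beta by (simp add: R_def field_simps)

lemma space_borel_on [simp]: "space (borel_on S) = S"
  by (simp add: space_restrict_space)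

lemma space_pair: "space (borel_on X \<Otimes>\<^sub>M borel_on U) = X \<times> U"
  by (simp add: space_pair_measure)

lemma T_in: "x \<in> X \<Longrightarrow> u \<in> U \<Longrightarrow> T (x, u) \<in> space (prob_algebra (borel_on X))"
  using measurable_space[OF T_kernel, of "(x, u)"] by (simp add: space_pair)

lemma prob_space_T: "x \<in> X \<Longrightarrow> u \<in> U \<Longrightarrow> prob_space (T (x, u))"
  and sets_T: "x \<in> X \<Longrightarrow> u \<in> U \<Longrightarrow> sets (T (x, u)) = sets (borel_on X)"
  using T_in by (auto simp: space_prob_algebra)

lemma space_T: "x \<in> X \<Longrightarrow> u \<in> U \<Longrightarrow> space (T (x, u)) = X"
  using sets_eq_imp_space_eq[OF sets_T] by simp

lemma measurable_T: "x \<in> X \<Longrightarrow> u \<in> U \<Longrightarrow> v \<in> borel_measurable (borel_on X) \<Longrightarrow> v \<in> borel_measurable (T (x, u))"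
  by (simp add: measurable_cong_sets[OF sets_T refl])

lemma measurable_into_U: "f \<in> N \<rightarrow>\<^sub>M count_space U \<longleftrightarrow> f \<in> N \<rightarrow>\<^sub>M borel_on U"
  by (simp add: measurable_cong_sets[OF refl sets_borel_on_finite[OF U_finite]])

text \<open>The sections \<open>c (_, u)\<close> are glued along the action coordinate, which takes
  only countably many values.\<close>

lemma c_measurable [measurable]: "c \<in> borel_measurable (borel_on X \<Otimes>\<^sub>M borel_on U)"
proof -
  have "(\<lambda>p. c (fst p, snd p)) \<in> borel_measurable (borel_on X \<Otimes>\<^sub>M borel_on U)"
  proof (rule measurable_compose_countable'[of U "\<lambda>u p. c (fst p, u)" _ _ snd])
    show "(\<lambda>p. c (fst p, u)) \<in> borel_measurable (borel_on X \<Otimes>\<^sub>M borel_on U)" if "u \<in> U" for u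
      using c_section[OF that] by (rule measurable_compose[OF measurable_fst])
  qed (auto simp: measurable_into_U U_finite countable_finite)
  then show ?thesis by simp
qed

lemma T_section: "u \<in> U \<Longrightarrow> (\<lambda>x. T (x, u)) \<in> borel_on X \<rightarrow>\<^sub>M prob_algebra (borel_on X)"
  by (rule measurable_compose[OF _ T_kernel]) simp

lemma integral_T_measurable:
  fixes v :: "'x \<Rightarrow> real"
  assumes "v \<in> borel_measurable (borel_on X)" "u \<in> U"
  shows "(\<lambda>x. \<integral>x'. v x' \<partial>T (x, u)) \<in> borel_measurable (borel_on X)"
  by (rule measurable_compose[OF measurable_prob_algebraD[OF T_section[OF assms(2)]]
        integral_measurable_subprob_algebra[OF assms(1)]])

lemma integrable_T:
  assumes "value_function v" "x \<in> X" "u \<in> U"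
  shows "integrable (T (x, u)) v"
  using assms
  by (intro prob_space.integrable_Icc[OF prob_space_T, of x u v 0 R] measurable_T)
    (auto simp: value_function_def space_T)

lemma integral_T_Icc:
  assumes "value_function v" "x \<in> X" "u \<in> U"
  shows "0 \<le> (\<integral>x'. v x' \<partial>T (x, u))" "(\<integral>x'. v x' \<partial>T (x, u)) \<le> R"
  using assms
    prob_space.integral_Icc[OF prob_space_T[OF assms(2,3)] measurable_T[OF assms(2,3)], of v 0 R]
  by (auto simp: value_function_def space_T)

text \<open>The operator preserves the bound since \<open>C + \<beta> * R = R\<close>, and
  measurability since a finite infimum of measurable functions is measurable. Averaging against
  \<open>T\<close> and taking infima are nonexpansive, so only the factor \<open>\<beta>\<close>
  remains.\<close>

lemma bellman_fixpoint:
  obtains V where "value_function V"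
    "\<And>x. x \<in> X \<Longrightarrow> V x = (INF u\<in>U. c (x, u) + \<beta> * (\<integral>x'. V x' \<partial>T (x, u)))"
proof (rule contraction_fixpoint[where Q=value_function and v\<^sub>0="\<lambda>_. 0" and S=X and R=R and \<beta>=\<beta>
      and F="\<lambda>V x. INF u\<in>U. c (x, u) + \<beta> * (\<integral>x'. V x' \<partial>T (x, u))"])
  show "value_function (\<lambda>_. 0)" by (simp add: value_function_def R_nonneg)
  show "value_function (\<lambda>x. INF u\<in>U. c (x, u) + \<beta> * (\<integral>x'. v x' \<partial>T (x, u)))" if v: "value_function v" for v
    unfolding value_function_def
  proof (intro conjI ballI)
    have "v \<in> borel_measurable (borel_on X)" using v by (simp add: value_function_def)
    then show "(\<lambda>x. INF u\<in>U. c (x, u) + \<beta> * (\<integral>x'. v x' \<partial>T (x, u))) \<in> borel_measurable (borel_on X)"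
      by (intro borel_measurable_cINF_real borel_measurable_add borel_measurable_times
          borel_measurable_const c_section integral_T_measurable countable_finite[OF U_finite])
    fix x assume x: "x \<in> X"
    show "0 \<le> (INF u\<in>U. c (x, u) + \<beta> * (\<integral>x'. v x' \<partial>T (x, u)))"
      using x integral_T_Icc[OF v x] c_nonneg beta by (intro cINF_greatest[OF U_nonempty]) simp
    obtain u where u: "u \<in> U" using U_nonempty by auto
    have "(INF u\<in>U. c (x, u) + \<beta> * (\<integral>x'. v x' \<partial>T (x, u))) \<le> c (x, u) + \<beta> * (\<integral>x'. v x' \<partial>T (x, u))"
      using u U_finite by (intro cINF_lower) auto
    also have "\<dots> \<le> C + \<beta> * R"
      using integral_T_Icc[OF v x u] c_le[OF x u] beta by (intro add_mono mult_left_mono) auto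
    finally show "(INF u\<in>U. c (x, u) + \<beta> * (\<integral>x'. v x' \<partial>T (x, u))) \<le> R" by (simp add: R_eq)
  qed
  show "\<bar>v x\<bar> \<le> R" if "value_function v" "x \<in> X" for v x
    using that by (auto simp: value_function_def)
  show "value_function v" if V: "\<And>n. value_function (V n)" and lim: "\<And>x. x \<in> X \<Longrightarrow> (\<lambda>n. V n x) \<longlonglongrightarrow> v x" for V v
    unfolding value_function_def
  proof (intro conjI ballI)
    show "v \<in> borel_measurable (borel_on X)"
      by (rule borel_measurable_LIMSEQ_metric[of V]) (use V lim in \<open>simp_all add: value_function_def\<close>)
    fix x assume x: "x \<in> X"
    then have "0 \<le> V n x" "V n x \<le> R" for n using V by (auto simp: value_function_def)
    then show "0 \<le> v x" "v x \<le> R"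
      using LIMSEQ_le_const[OF lim[OF x]] LIMSEQ_le_const2[OF lim[OF x]] by blast+
  qed
  show "\<bar>(INF u\<in>U. c (x, u) + \<beta> * (\<integral>x'. v x' \<partial>T (x, u))) - (INF u\<in>U. c (x, u) + \<beta> * (\<integral>x'. w x' \<partial>T (x, u)))\<bar> \<le> \<beta> * e"
    if v: "value_function v" and w: "value_function w" and e: "\<And>x. x \<in> X \<Longrightarrow> \<bar>v x - w x\<bar> \<le> e" and x: "x \<in> X" for v w e x
  proof (rule abs_INF_diff_le[OF U_finite U_nonempty])
    fix u assume u: "u \<in> U"
    have "\<bar>(\<integral>x'. v x' \<partial>T (x, u)) - (\<integral>x'. w x' \<partial>T (x, u))\<bar> \<le> e"
      using x u e by (intro prob_space.abs_integral_diff_le prob_space_T integrable_T v w) (auto simp: space_T)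
    then have "\<bar>\<beta> * ((\<integral>x'. v x' \<partial>T (x, u)) - (\<integral>x'. w x' \<partial>T (x, u)))\<bar> \<le> \<beta> * e"
      using beta by (simp add: abs_mult)
    then show "\<bar>c (x, u) + \<beta> * (\<integral>x'. v x' \<partial>T (x, u)) - (c (x, u) + \<beta> * (\<integral>x'. w x' \<partial>T (x, u)))\<bar> \<le> \<beta> * e"
      by (simp add: algebra_simps)
  qed
qed (use beta in auto)

section \<open>The law of state-action trajectories\<close>

abbreviation "law \<gamma> x\<^sub>0 \<equiv> mdp_measure X U T \<gamma> x\<^sub>0"

context
  fixes \<gamma> :: "('x, 'u) policy" and x\<^sub>0 :: 'x
  assumes \<gamma>: "\<gamma> \<in> admissible X U" and x0: "x\<^sub>0 \<in> X"
begin

interpretation IT: Ionescu_Tulcea "mdp_step X U T \<gamma> x\<^sub>0" "\<lambda>_. borel_on X \<Otimes>\<^sub>M borel_on U"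
  by (rule Ionescu_Tulcea_mdp_step[OF T_kernel \<gamma> x0])

lemma law_eq: "law \<gamma> x\<^sub>0 = IT.PF.lim"
  by (simp add: mdp_measure_def Let_def)

lemma sets_law: "sets (law \<gamma> x\<^sub>0) = sets (PiM UNIV (\<lambda>_. borel_on X \<Otimes>\<^sub>M borel_on U))"
  by (simp add: law_eq)

lemma prob_space_law: "prob_space (law \<gamma> x\<^sub>0)"
  using IT.prob_space_lim by (simp add: law_eq)

lemma coordinate_law: "\<omega> \<in> space (law \<gamma> x\<^sub>0) \<Longrightarrow> fst (\<omega> n) \<in> X \<and> snd (\<omega> n) \<in> U"
  using measurable_space[OF measurable_component_singleton[of n UNIV "\<lambda>_. borel_on X \<Otimes>\<^sub>M borel_on U"], of \<omega>]
    sets_eq_imp_space_eq[OF sets_law] by (auto simp: space_pair)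

lemma measurable_coordinate_law [measurable]: "(\<lambda>\<omega>. \<omega> n) \<in> law \<gamma> x\<^sub>0 \<rightarrow>\<^sub>M borel_on X \<Otimes>\<^sub>M borel_on U"
  by (simp add: measurable_cong_sets[OF sets_law refl])

lemma nn_integral_mdp_step:
  assumes h: "h \<in> borel_measurable (borel_on X \<Otimes>\<^sub>M borel_on U)" and \<omega>: "\<And>i. i < n \<Longrightarrow> \<omega> i \<in> X \<times> U"
  shows "(\<integral>\<^sup>+z. h z \<partial>mdp_step X U T \<gamma> x\<^sub>0 n \<omega>) =
    (\<integral>\<^sup>+x. h (x, \<gamma> n (\<lambda>i\<in>{..n}. if i = n then x else fst (\<omega> i), \<lambda>i\<in>{..<n}. snd (\<omega> i)))
      \<partial>(if n = 0 then return (borel_on X) x\<^sub>0 else T (\<omega> (n - 1))))"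
proof -
  let ?K = "if n = 0 then return (borel_on X) x\<^sub>0 else T (\<omega> (n - 1))"
  have K: "sets ?K = sets (borel_on X)"
    using \<omega>[of "n - 1"] sets_T by (cases "\<omega> (n - 1)") auto
  have g: "\<gamma> n \<in> (PiM {..n} (\<lambda>_. borel_on X)) \<Otimes>\<^sub>M (PiM {..<n} (\<lambda>_. borel_on U)) \<rightarrow>\<^sub>M borel_on U"
    using \<gamma> by (simp add: admissible_def)
  have c1: "(\<lambda>x. if i = n then x else fst (\<omega> i)) \<in> borel_on X \<rightarrow>\<^sub>M borel_on X" if "i \<in> {..n}" for i
    using \<omega>[of i] that by (cases "i = n") auto
  have c2: "(\<lambda>x. snd (\<omega> i)) \<in> borel_on X \<rightarrow>\<^sub>M borel_on U" if "i \<in> {..<n}" for i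
    using \<omega>[of i] that by auto
  have "(\<lambda>x. (x, \<gamma> n (\<lambda>i\<in>{..n}. if i = n then x else fst (\<omega> i), \<lambda>i\<in>{..<n}. snd (\<omega> i))))
     \<in> borel_on X \<rightarrow>\<^sub>M borel_on X \<Otimes>\<^sub>M borel_on U"
    by (intro measurable_Pair measurable_ident_sets[OF refl] measurable_compose[OF _ g] measurable_restrict c1 c2)
  then show ?thesis
    unfolding mdp_step_def using h
    by (subst nn_integral_distr) (auto simp: measurable_cong_sets[OF K refl])
qed

text \<open>The step kernel is the law of the new state, pushed through the map that attaches the
  action. The case \<open>n = 0\<close> is split off since the truncated \<open>n - 1\<close> would
  then refer to coordinate 0 itself.\<close>

lemma nn_integral_law_coordinate:
  assumes h: "h \<in> borel_measurable (borel_on X \<Otimes>\<^sub>M borel_on U)"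
  shows "(\<integral>\<^sup>+\<omega>. h (\<omega> n) \<partial>law \<gamma> x\<^sub>0) = (\<integral>\<^sup>+\<omega>. (\<integral>\<^sup>+x.
      h (x, \<gamma> n (\<lambda>i\<in>{..n}. if i = n then x else fst (\<omega> i), \<lambda>i\<in>{..<n}. snd (\<omega> i)))
      \<partial>(if n = 0 then return (borel_on X) x\<^sub>0 else T (\<omega> (n - 1)))) \<partial>law \<gamma> x\<^sub>0)"
  unfolding law_eq IT.nn_integral_lim_component[OF h]
proof (rule nn_integral_cong)
  fix \<omega> assume "\<omega> \<in> space IT.PF.lim"
  then have \<omega>: "\<omega> i \<in> X \<times> U" for i
    using coordinate_law[of \<omega> i] by (simp add: law_eq mem_Times_iff)
  \<comment> \<open>The history handed to the policy reads \<open>\<omega>\<close> only below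
    \<open>n\<close>, where the restriction changes nothing.\<close>
  have "(\<lambda>i\<in>{..n}. if i = n then x else fst (restrict \<omega> {0..<n} i)) = (\<lambda>i\<in>{..n}. if i = n then x else fst (\<omega> i))"
    "(\<lambda>i\<in>{..<n}. snd (restrict \<omega> {0..<n} i)) = (\<lambda>i\<in>{..<n}. snd (\<omega> i))" for x
    by (auto intro!: restrict_ext)
  then show "(\<integral>\<^sup>+z. h z \<partial>mdp_step X U T \<gamma> x\<^sub>0 n (restrict \<omega> {0..<n})) = (\<integral>\<^sup>+x.
      h (x, \<gamma> n (\<lambda>i\<in>{..n}. if i = n then x else fst (\<omega> i), \<lambda>i\<in>{..<n}. snd (\<omega> i)))
      \<partial>(if n = 0 then return (borel_on X) x\<^sub>0 else T (\<omega> (n - 1))))"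
    using \<omega> by (subst nn_integral_mdp_step[OF h]) auto
qed

lemma nn_integral_law_0:
  assumes h: "h \<in> borel_measurable (borel_on X)"
  shows "(\<integral>\<^sup>+\<omega>. h (fst (\<omega> 0)) \<partial>law \<gamma> x\<^sub>0) = h x\<^sub>0"
  using nn_integral_law_coordinate[OF measurable_compose[OF measurable_fst h], of 0] x0 h
  by (simp add: nn_integral_return prob_space.emeasure_space_1[OF prob_space_law])

text \<open>A function of the state does not see the action attached at time \<open>Suc n\<close>,
  so the policy vanishes from the inner integral.\<close>

lemma nn_integral_law_Suc:
  assumes h: "h \<in> borel_measurable (borel_on X)"
  shows "(\<integral>\<^sup>+\<omega>. h (fst (\<omega> (Suc n))) \<partial>law \<gamma> x\<^sub>0) = (\<integral>\<^sup>+\<omega>. (\<integral>\<^sup>+x. h x \<partial>T (\<omega> n)) \<partial>law \<gamma> x\<^sub>0)"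
  using nn_integral_law_coordinate[OF measurable_compose[OF measurable_fst h], of "Suc n"] by simp

end

lemma stationary_admissible:
  assumes "f \<in> borel_on X \<rightarrow>\<^sub>M borel_on U"
  shows "stationary f \<in> admissible X U"
  unfolding admissible_def stationary_def split_beta
  by (auto intro!: measurable_compose[OF _ assms] measurable_compose[OF measurable_fst] measurable_component_singleton)

text \<open>The trajectory space also contains paths whose actions disagree with \<open>f\<close>,
  so the integrands differ pointwise. Expanding one step on each side puts \<open>f x\<close> in the
  action slot both times.\<close>

lemma nn_integral_law_stationary:
  assumes f: "f \<in> borel_on X \<rightarrow>\<^sub>M borel_on U" and x0: "x\<^sub>0 \<in> X"
    and h: "h \<in> borel_measurable (borel_on X \<Otimes>\<^sub>M borel_on U)"
  shows "(\<integral>\<^sup>+\<omega>. h (\<omega> n) \<partial>law (stationary f) x\<^sub>0) = (\<integral>\<^sup>+\<omega>. h (fst (\<omega> n), f (fst (\<omega> n))) \<partial>law (stationary f) x\<^sub>0)"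
proof -
  have h': "(\<lambda>z. h (fst z, f (fst z))) \<in> borel_measurable (borel_on X \<Otimes>\<^sub>M borel_on U)"
    by (intro measurable_compose[OF _ h] measurable_Pair measurable_fst measurable_compose[OF measurable_fst f])
  note adm = stationary_admissible[OF f]
  show ?thesis
    unfolding nn_integral_law_coordinate[OF adm x0 h] nn_integral_law_coordinate[OF adm x0 h']
    by (simp add: stationary_def)
qed

lemma nn_integral_discounted:
  assumes \<gamma>: "\<gamma> \<in> admissible X U" and x0: "x\<^sub>0 \<in> X"
    and h: "h \<in> borel_measurable (borel_on X \<Otimes>\<^sub>M borel_on U)"
  shows "(\<integral>\<^sup>+\<omega>. (\<Sum>t. ennreal (\<beta> ^ t) * h (\<omega> t)) \<partial>law \<gamma> x\<^sub>0) =
    (\<Sum>t. ennreal (\<beta> ^ t) * (\<integral>\<^sup>+\<omega>. h (\<omega> t) \<partial>law \<gamma> x\<^sub>0))"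
proof -
  have [measurable]: "(\<lambda>\<omega>. h (\<omega> t)) \<in> borel_measurable (law \<gamma> x\<^sub>0)" for t
    by (rule measurable_compose[OF measurable_coordinate_law[OF \<gamma> x0] h])
  show ?thesis
    by (simp add: nn_integral_suminf nn_integral_cmult)
qed

text \<open>Shared by the lower bound on the cost and by the error bound. With \<open>a t\<close>
  the mean of \<open>v\<close> at time \<open>t\<close>, the integral against
  \<open>T (\<omega> t)\<close> is \<open>a (Suc t)\<close>, and \<open>step\<close> becomes the
  scalar recursion.\<close>

lemma trajectory_bound:
  assumes \<gamma>: "\<gamma> \<in> admissible X U" and x0: "x\<^sub>0 \<in> X"
    and v: "v \<in> borel_measurable (borel_on X)" "\<And>x. x \<in> X \<Longrightarrow> 0 \<le> v x" "\<And>x. x \<in> X \<Longrightarrow> v x \<le> b"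
    and g: "\<And>t. g t \<in> borel_measurable (law \<gamma> x\<^sub>0)"
    and step: "\<And>t. (\<integral>\<^sup>+\<omega>. ennreal (v (fst (\<omega> t))) \<partial>law \<gamma> x\<^sub>0) \<le>
      (\<integral>\<^sup>+\<omega>. g t \<omega> \<partial>law \<gamma> x\<^sub>0) + ennreal \<beta> * (\<integral>\<^sup>+\<omega>. (\<integral>\<^sup>+x. ennreal (v x) \<partial>T (\<omega> t)) \<partial>law \<gamma> x\<^sub>0)"
  shows "ennreal (v x\<^sub>0) \<le> (\<Sum>t. ennreal (\<beta> ^ t) * (\<integral>\<^sup>+\<omega>. g t \<omega> \<partial>law \<gamma> x\<^sub>0))"
proof -
  interpret prob_space "law \<gamma> x\<^sub>0" by (rule prob_space_law[OF \<gamma> x0])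
  have v': "(\<lambda>x. ennreal (v x)) \<in> borel_measurable (borel_on X)" using v(1) by measurable
  define a where "a t = (\<integral>\<^sup>+\<omega>. ennreal (v (fst (\<omega> t))) \<partial>law \<gamma> x\<^sub>0)" for t
  have "a 0 \<le> (\<Sum>t. ennreal (\<beta> ^ t) * (\<integral>\<^sup>+\<omega>. g t \<omega> \<partial>law \<gamma> x\<^sub>0))"
  proof (rule discounted_recursion_bound)
    show "a t \<le> (\<integral>\<^sup>+\<omega>. g t \<omega> \<partial>law \<gamma> x\<^sub>0) + ennreal \<beta> * a (Suc t)" for t
      using step[of t] unfolding a_def nn_integral_law_Suc[OF \<gamma> x0 v'] .
    have "a t \<le> (\<integral>\<^sup>+\<omega>. ennreal b \<partial>law \<gamma> x\<^sub>0)" for t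
      unfolding a_def using coordinate_law[OF \<gamma> x0] v(3) by (intro nn_integral_mono ennreal_leI) auto
    then show "a t \<le> ennreal b" for t by (simp add: emeasure_space_1)
  qed (use beta in auto)
  then show ?thesis
    by (simp add: a_def nn_integral_law_0[OF \<gamma> x0 v'])
qed

end

section \<open>Optimality of the Bellman fixed point\<close>

context finite_action_mdp
begin

lemma nn_integral_T_eq:
  assumes "value_function v" "x \<in> X" "u \<in> U"
  shows "(\<integral>\<^sup>+x'. ennreal (v x') \<partial>T (x, u)) = ennreal (\<integral>x'. v x' \<partial>T (x, u))"
  using assms by (intro nn_integral_eq_integral integrable_T AE_I2) (auto simp: space_T value_function_def)

lemma ennreal_step:
  assumes v: "value_function v" and x: "x \<in> X" and u: "u \<in> U"
  shows "ennreal (c (x, u)) + ennreal \<beta> * (\<integral>\<^sup>+x'. ennreal (v x') \<partial>T (x, u)) =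
    ennreal (c (x, u) + \<beta> * (\<integral>x'. v x' \<partial>T (x, u)))"
  using integral_T_Icc(1)[OF assms] c_nonneg[OF x u] beta
  by (simp add: nn_integral_T_eq[OF assms] ennreal_mult ennreal_plus)

lemma nn_integral_T_measurable:
  assumes "v \<in> borel_measurable (borel_on X)"
  shows "(\<lambda>z. \<integral>\<^sup>+x'. v x' \<partial>T z) \<in> borel_measurable (borel_on X \<Otimes>\<^sub>M borel_on U)"
  by (rule measurable_compose[OF measurable_prob_algebraD[OF T_kernel]
        nn_integral_measurable_subprob_algebra[OF assms]])

text \<open>Moves the real-valued cost to \<open>ennreal\<close>, where sum and expectation commute.
  Domination by the geometric series \<open>\<beta> ^ t * C\<close> gives convergence and
  integrability; nonnegativity allows the way back to the reals.\<close>

lemma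
  assumes \<gamma>: "\<gamma> \<in> admissible X U" and x0: "x\<^sub>0 \<in> X"
  shows discounted_cost_eq: "ennreal (discounted_cost X U T c \<beta> x\<^sub>0 \<gamma>) =
      (\<Sum>t. ennreal (\<beta> ^ t) * (\<integral>\<^sup>+\<omega>. ennreal (c (\<omega> t)) \<partial>law \<gamma> x\<^sub>0))"
    and discounted_cost_nonneg: "0 \<le> discounted_cost X U T c \<beta> x\<^sub>0 \<gamma>"
proof -
  interpret prob_space "law \<gamma> x\<^sub>0" by (rule prob_space_law[OF \<gamma> x0])
  have coord: "0 \<le> c (\<omega> t)" "c (\<omega> t) \<le> C" if "\<omega> \<in> space (law \<gamma> x\<^sub>0)" for \<omega> t
    using coordinate_law[OF \<gamma> x0 that, of t] c_nonneg[of "fst (\<omega> t)" "snd (\<omega> t)"]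
      c_le[of "fst (\<omega> t)" "snd (\<omega> t)"] by auto
  have geo: "(\<lambda>t. \<beta> ^ t * C) sums R"
    using sums_mult2[OF geometric_sums[of \<beta>], of C] beta by (simp add: R_def)
  have summable: "summable (\<lambda>t. \<beta> ^ t * c (\<omega> t))" if "\<omega> \<in> space (law \<gamma> x\<^sub>0)" for \<omega>
    by (rule summable_comparison_test'[OF sums_summable[OF geo], of 0])
      (use coord[OF that] beta in \<open>simp add: abs_mult mult_left_mono\<close>)
  have bounds: "0 \<le> (\<Sum>t. \<beta> ^ t * c (\<omega> t))" "(\<Sum>t. \<beta> ^ t * c (\<omega> t)) \<le> R" if "\<omega> \<in> space (law \<gamma> x\<^sub>0)" for \<omega>
  proof -
    show "0 \<le> (\<Sum>t. \<beta> ^ t * c (\<omega> t))"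
      using coord[OF that] beta by (intro suminf_nonneg summable that) simp
    have "(\<Sum>t. \<beta> ^ t * c (\<omega> t)) \<le> (\<Sum>t. \<beta> ^ t * C)"
      using coord[OF that] beta by (intro suminf_le summable that sums_summable[OF geo] mult_left_mono) auto
    then show "(\<Sum>t. \<beta> ^ t * c (\<omega> t)) \<le> R" using sums_unique[OF geo] by simp
  qed
  have [measurable]: "(\<lambda>\<omega>. c (\<omega> t)) \<in> borel_measurable (law \<gamma> x\<^sub>0)" for t
    by (rule measurable_compose[OF measurable_coordinate_law[OF \<gamma> x0] c_measurable])
  have meas: "(\<lambda>\<omega>. \<Sum>t. \<beta> ^ t * c (\<omega> t)) \<in> borel_measurable (law \<gamma> x\<^sub>0)"
    by measurable
  have "ennreal (discounted_cost X U T c \<beta> x\<^sub>0 \<gamma>) = (\<integral>\<^sup>+\<omega>. ennreal (\<Sum>t. \<beta> ^ t * c (\<omega> t)) \<partial>law \<gamma> x\<^sub>0)"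
    unfolding discounted_cost_def using bounds(1)
    by (intro nn_integral_eq_integral[symmetric] integrable_Icc[OF meas bounds] AE_I2) auto
  also have "\<dots> = (\<integral>\<^sup>+\<omega>. (\<Sum>t. ennreal (\<beta> ^ t) * ennreal (c (\<omega> t))) \<partial>law \<gamma> x\<^sub>0)"
  proof (rule nn_integral_cong)
    fix \<omega> assume \<omega>: "\<omega> \<in> space (law \<gamma> x\<^sub>0)"
    then have "ennreal (\<Sum>t. \<beta> ^ t * c (\<omega> t)) = (\<Sum>t. ennreal (\<beta> ^ t * c (\<omega> t)))"
      using coord beta by (intro suminf_ennreal2[symmetric] summable) auto
    then show "ennreal (\<Sum>t. \<beta> ^ t * c (\<omega> t)) = (\<Sum>t. ennreal (\<beta> ^ t) * ennreal (c (\<omega> t)))"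
      using coord[OF \<omega>] beta by (simp add: ennreal_mult)
  qed
  also have "\<dots> = (\<Sum>t. ennreal (\<beta> ^ t) * (\<integral>\<^sup>+\<omega>. ennreal (c (\<omega> t)) \<partial>law \<gamma> x\<^sub>0))"
    by (rule nn_integral_discounted[OF \<gamma> x0]) measurable
  finally show "ennreal (discounted_cost X U T c \<beta> x\<^sub>0 \<gamma>) = \<dots>" .
  show "0 \<le> discounted_cost X U T c \<beta> x\<^sub>0 \<gamma>"
    unfolding discounted_cost_def using bounds(1) by (intro integral_nonneg_AE AE_I2)
qed

text \<open>The Bellman inequality is taken for all actions because an admissible policy may choose
  any of them at time \<open>t\<close>.\<close>

lemma value_le_discounted_cost:
  assumes V: "value_function V"
    and bellman: "\<And>x u. x \<in> X \<Longrightarrow> u \<in> U \<Longrightarrow> V x \<le> c (x, u) + \<beta> * (\<integral>x'. V x' \<partial>T (x, u))"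
    and \<gamma>: "\<gamma> \<in> admissible X U" and x0: "x\<^sub>0 \<in> X"
  shows "V x\<^sub>0 \<le> discounted_cost X U T c \<beta> x\<^sub>0 \<gamma>"
proof -
  have V': "(\<lambda>x. ennreal (V x)) \<in> borel_measurable (borel_on X)"
    using V by (auto simp: value_function_def)
  note meas[measurable] =
    measurable_compose[OF measurable_coordinate_law[OF \<gamma> x0] c_measurable]
    measurable_compose[OF measurable_coordinate_law[OF \<gamma> x0] nn_integral_T_measurable[OF V']]
  have "ennreal (V x\<^sub>0) \<le> (\<Sum>t. ennreal (\<beta> ^ t) * (\<integral>\<^sup>+\<omega>. ennreal (c (\<omega> t)) \<partial>law \<gamma> x\<^sub>0))"
  proof (rule trajectory_bound[OF \<gamma> x0])
    fix t
    have "(\<integral>\<^sup>+\<omega>. ennreal (V (fst (\<omega> t))) \<partial>law \<gamma> x\<^sub>0) \<le>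
        (\<integral>\<^sup>+\<omega>. ennreal (c (\<omega> t)) + ennreal \<beta> * (\<integral>\<^sup>+x. ennreal (V x) \<partial>T (\<omega> t)) \<partial>law \<gamma> x\<^sub>0)"
    proof (rule nn_integral_mono)
      fix \<omega> assume "\<omega> \<in> space (law \<gamma> x\<^sub>0)"
      then have "fst (\<omega> t) \<in> X" "snd (\<omega> t) \<in> U" using coordinate_law[OF \<gamma> x0] by auto
      from ennreal_step[OF V this] bellman[OF this]
      show "ennreal (V (fst (\<omega> t))) \<le> ennreal (c (\<omega> t)) + ennreal \<beta> * (\<integral>\<^sup>+x. ennreal (V x) \<partial>T (\<omega> t))"
        by (simp add: ennreal_leI)
    qed
    also have "\<dots> = (\<integral>\<^sup>+\<omega>. ennreal (c (\<omega> t)) \<partial>law \<gamma> x\<^sub>0) +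
        ennreal \<beta> * (\<integral>\<^sup>+\<omega>. (\<integral>\<^sup>+x. ennreal (V x) \<partial>T (\<omega> t)) \<partial>law \<gamma> x\<^sub>0)"
      by (subst nn_integral_add) (simp_all add: nn_integral_cmult)
    finally show "(\<integral>\<^sup>+\<omega>. ennreal (V (fst (\<omega> t))) \<partial>law \<gamma> x\<^sub>0) \<le> \<dots>" .
  qed (use V in \<open>auto simp: value_function_def\<close>)
  then show ?thesis
    using discounted_cost_nonneg[OF \<gamma> x0] by (simp flip: discounted_cost_eq[OF \<gamma> x0])
qed

lemma discounted_cost_stationary_le:
  assumes V: "value_function V" and f: "f \<in> borel_on X \<rightarrow>\<^sub>M borel_on U"
    and bellman: "\<And>x. x \<in> X \<Longrightarrow> c (x, f x) + \<beta> * (\<integral>x'. V x' \<partial>T (x, f x)) \<le> V x"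
    and x0: "x\<^sub>0 \<in> X"
  shows "discounted_cost X U T c \<beta> x\<^sub>0 (stationary f) \<le> V x\<^sub>0"
proof -
  let ?P = "law (stationary f) x\<^sub>0"
  note \<gamma> = stationary_admissible[OF f]
  have V': "(\<lambda>x. ennreal (V x)) \<in> borel_measurable (borel_on X)"
    using V by (auto simp: value_function_def)
  note meas[measurable] =
    measurable_compose[OF measurable_coordinate_law[OF \<gamma> x0] c_measurable]
    measurable_compose[OF measurable_coordinate_law[OF \<gamma> x0] nn_integral_T_measurable[OF V']]
  let ?a = "\<lambda>t. \<integral>\<^sup>+\<omega>. ennreal (V (fst (\<omega> t))) \<partial>?P"
  let ?h = "\<lambda>z. ennreal (c z) + ennreal \<beta> * (\<integral>\<^sup>+x. ennreal (V x) \<partial>T z)"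
  have h: "?h \<in> borel_measurable (borel_on X \<Otimes>\<^sub>M borel_on U)"
    using nn_integral_T_measurable[OF V'] by measurable
  have "(\<Sum>t. ennreal (\<beta> ^ t) * (\<integral>\<^sup>+\<omega>. ennreal (c (\<omega> t)) \<partial>?P)) \<le> ?a 0"
  proof (rule discounted_recursion_ge)
    fix t
    have "(\<integral>\<^sup>+\<omega>. ennreal (c (\<omega> t)) \<partial>?P) + ennreal \<beta> * ?a (Suc t) = (\<integral>\<^sup>+\<omega>. ?h (\<omega> t) \<partial>?P)"
      unfolding nn_integral_law_Suc[OF \<gamma> x0 V'] by (subst nn_integral_add) (simp_all add: nn_integral_cmult)
    \<comment> \<open>The inequality \<open>bellman\<close> holds at the actions of \<open>f\<close>
      only, so the recorded action is exchanged for \<open>f\<close> before comparing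
      pointwise.\<close>
    also have "\<dots> = (\<integral>\<^sup>+\<omega>. ?h (fst (\<omega> t), f (fst (\<omega> t))) \<partial>?P)"
      by (rule nn_integral_law_stationary[OF f x0 h])
    also have "\<dots> \<le> ?a t"
    proof (rule nn_integral_mono)
      fix \<omega> assume "\<omega> \<in> space ?P"
      then have x: "fst (\<omega> t) \<in> X" using coordinate_law[OF \<gamma> x0] by auto
      then have "f (fst (\<omega> t)) \<in> U" using measurable_space[OF f] by simp
      from ennreal_step[OF V x this] bellman[OF x]
      show "?h (fst (\<omega> t), f (fst (\<omega> t))) \<le> ennreal (V (fst (\<omega> t)))"
        by (simp add: ennreal_leI)
    qed
    finally show "(\<integral>\<^sup>+\<omega>. ennreal (c (\<omega> t)) \<partial>?P) + ennreal \<beta> * ?a (Suc t) \<le> ?a t" .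
  qed (use beta in simp)
  then show ?thesis
    using V x0 by (simp flip: discounted_cost_eq[OF \<gamma> x0] add: nn_integral_law_0[OF \<gamma> x0 V'] value_function_def)
qed

text \<open>A measurable minimizing selector reaches \<open>V\<close>, and no admissible policy
  falls below it.\<close>

lemma optimal_cost_eq:
  assumes V: "value_function V"
    and bellman: "\<And>x. x \<in> X \<Longrightarrow> V x = (INF u\<in>U. c (x, u) + \<beta> * (\<integral>x'. V x' \<partial>T (x, u)))"
    and x0: "x\<^sub>0 \<in> X"
  shows "optimal_cost X U T c \<beta> x\<^sub>0 = V x\<^sub>0"
proof (rule antisym)
  have Vm: "V \<in> borel_measurable (borel_on X)" using V by (simp add: value_function_def)
  \<comment> \<open>The selection lemma maximizes, hence the sign.\<close>
  have "(\<lambda>x. - (c (x, u) + \<beta> * (\<integral>x'. V x' \<partial>T (x, u)))) \<in> borel_measurable (borel_on X)" if "u \<in> U" for u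
    using that by (intro borel_measurable_uminus borel_measurable_add borel_measurable_times
        borel_measurable_const c_section integral_T_measurable[OF Vm])
  then obtain f where f: "f \<in> borel_on X \<rightarrow>\<^sub>M count_space U"
    and opt: "\<And>x. x \<in> space (borel_on X) \<Longrightarrow> - (c (x, f x) + \<beta> * (\<integral>x'. V x' \<partial>T (x, f x))) =
      (SUP u\<in>U. - (c (x, u) + \<beta> * (\<integral>x'. V x' \<partial>T (x, u))))"
    using measurable_argmax_finite[OF U_finite U_nonempty,
        of "\<lambda>x u. - (c (x, u) + \<beta> * (\<integral>x'. V x' \<partial>T (x, u)))" "borel_on X"] by blast
  have f': "f \<in> borel_on X \<rightarrow>\<^sub>M borel_on U" using f by (simp add: measurable_into_U)
  have "c (x, f x) + \<beta> * (\<integral>x'. V x' \<partial>T (x, f x)) \<le> V x" if "x \<in> X" for x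
    \<comment> \<open>On the reals \<open>Inf\<close> is defined as the negated supremum of the
      negated set, which matches \<open>opt\<close>.\<close>
    using opt[of x] bellman[OF that] that by (simp add: Inf_real_def image_image)
  from discounted_cost_stationary_le[OF V f' this x0]
  show "optimal_cost X U T c \<beta> x\<^sub>0 \<le> V x\<^sub>0"
    unfolding optimal_cost_def using discounted_cost_nonneg[OF _ x0]
    by (intro cINF_lower2[OF _ stationary_admissible[OF f']] bdd_belowI2) auto
  have "V x \<le> c (x, u) + \<beta> * (\<integral>x'. V x' \<partial>T (x, u))" if "x \<in> X" "u \<in> U" for x u
    unfolding bellman[OF that(1)] using that(2) U_finite by (intro cINF_lower) auto
  then show "V x\<^sub>0 \<le> optimal_cost X U T c \<beta> x\<^sub>0"
    unfolding optimal_cost_def using stationary_admissible[OF f']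
    by (intro cINF_greatest value_le_discounted_cost[OF V _ _ x0]) auto
qed

text \<open>The hypothesis \<open>step\<close> is iterated along the trajectory of \<open>f\<close>.
  It is stated in \<open>ennreal\<close> since \<open>l\<close> may be infinite, while
  \<open>D\<close> is bounded so that the remainder vanishes.\<close>

lemma error_propagation:
  assumes D: "D \<in> borel_measurable (borel_on X)" "\<And>x. x \<in> X \<Longrightarrow> 0 \<le> D x" "\<And>x. x \<in> X \<Longrightarrow> D x \<le> b"
    and f: "f \<in> borel_on X \<rightarrow>\<^sub>M borel_on U" and l: "l \<in> borel_measurable (borel_on X)"
    and step: "\<And>x. x \<in> X \<Longrightarrow> ennreal (D x) \<le> ennreal K * l x + ennreal \<beta> * ennreal (\<integral>x'. D x' \<partial>T (x, f x))"
    and x0: "x\<^sub>0 \<in> X"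
  shows "ennreal (D x\<^sub>0) \<le> ennreal K * expected_discounted X U T l \<beta> x\<^sub>0 (stationary f)"
proof -
  let ?P = "law (stationary f) x\<^sub>0"
  note \<gamma> = stationary_admissible[OF f]
  have D': "(\<lambda>x. ennreal (D x)) \<in> borel_measurable (borel_on X)" using D(1) by measurable
  have l': "(\<lambda>z. l (fst z)) \<in> borel_measurable (borel_on X \<Otimes>\<^sub>M borel_on U)"
    by (rule measurable_compose[OF measurable_fst l])
  let ?h = "\<lambda>z. \<integral>\<^sup>+x. ennreal (D x) \<partial>T z"
  have h: "?h \<in> borel_measurable (borel_on X \<Otimes>\<^sub>M borel_on U)" by (rule nn_integral_T_measurable[OF D'])
  have hf: "(\<lambda>z. ?h (fst z, f (fst z))) \<in> borel_measurable (borel_on X \<Otimes>\<^sub>M borel_on U)"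
    by (intro measurable_compose[OF _ h] measurable_Pair measurable_fst measurable_compose[OF measurable_fst f])
  note meas[measurable] =
    measurable_compose[OF measurable_coordinate_law[OF \<gamma> x0] l']
    measurable_compose[OF measurable_coordinate_law[OF \<gamma> x0] hf]
  have "ennreal (D x\<^sub>0) \<le> (\<Sum>t. ennreal (\<beta> ^ t) * (\<integral>\<^sup>+\<omega>. ennreal K * l (fst (\<omega> t)) \<partial>?P))"
  proof (rule trajectory_bound[OF \<gamma> x0 D])
    fix t
    have "(\<integral>\<^sup>+\<omega>. ennreal (D (fst (\<omega> t))) \<partial>?P) \<le>
        (\<integral>\<^sup>+\<omega>. ennreal K * l (fst (\<omega> t)) + ennreal \<beta> * ?h (fst (\<omega> t), f (fst (\<omega> t))) \<partial>?P)"
    proof (rule nn_integral_mono)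
      fix \<omega> assume "\<omega> \<in> space ?P"
      then have x: "fst (\<omega> t) \<in> X" using coordinate_law[OF \<gamma> x0] by auto
      then have u: "f (fst (\<omega> t)) \<in> U" using measurable_space[OF f] by simp
      have "?h (fst (\<omega> t), f (fst (\<omega> t))) = ennreal (\<integral>x'. D x' \<partial>T (fst (\<omega> t), f (fst (\<omega> t))))"
        by (intro nn_integral_eq_integral AE_I2
            prob_space.integrable_Icc[OF prob_space_T[OF x u] measurable_T[OF x u D(1)], of 0 b])
          (auto simp: space_T[OF x u] D)
      then show "ennreal (D (fst (\<omega> t))) \<le> ennreal K * l (fst (\<omega> t)) + ennreal \<beta> * ?h (fst (\<omega> t), f (fst (\<omega> t)))"
        using step[OF x] by simp
    qed
    also have "\<dots> = (\<integral>\<^sup>+\<omega>. ennreal K * l (fst (\<omega> t)) \<partial>?P) + ennreal \<beta> * (\<integral>\<^sup>+\<omega>. ?h (fst (\<omega> t), f (fst (\<omega> t))) \<partial>?P)"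
      by (subst nn_integral_add) (simp_all add: nn_integral_cmult)
    \<comment> \<open>The action of \<open>f\<close> is turned back into the recorded one, the form
      in which \<open>trajectory_bound\<close> expects the kernel.\<close>
    finally show "(\<integral>\<^sup>+\<omega>. ennreal (D (fst (\<omega> t))) \<partial>?P) \<le>
        (\<integral>\<^sup>+\<omega>. ennreal K * l (fst (\<omega> t)) \<partial>?P) + ennreal \<beta> * (\<integral>\<^sup>+\<omega>. ?h (\<omega> t) \<partial>?P)"
      by (simp only: nn_integral_law_stationary[OF f x0 h])
  qed measurable
  also have "\<dots> = ennreal K * expected_discounted X U T l \<beta> x\<^sub>0 (stationary f)"
    unfolding expected_discounted_def nn_integral_discounted[OF \<gamma> x0 l']
    by (simp add: nn_integral_cmult mult.left_commute[of _ "ennreal K"])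
  finally show ?thesis .
qed

end

section \<open>The finite model\<close>

locale quantized_mdp = finite_action_mdp X U T c \<beta> C
  for X :: "'x::topological_space set" and U :: "'u::t1_space set" and T c \<beta> C +
  fixes B :: "nat \<Rightarrow> 'x set" and M :: nat and y :: "nat \<Rightarrow> 'x" and \<pi> :: "'x measure"
  assumes B_meas: "\<And>i. i \<in> {1..M} \<Longrightarrow> B i \<in> sets (borel_on X)"
    and B_disj: "disjoint_family_on B {1..M}"
    and B_cover: "(\<Union>i\<in>{1..M}. B i) = X"
    and prob_space_\<pi>: "prob_space \<pi>" and sets_\<pi>: "sets \<pi> = sets (borel_on X)"
    and \<pi>_pos: "\<And>i. i \<in> {1..M} \<Longrightarrow> 0 < measure \<pi> (B i)"
    and y_repr: "\<And>i. i \<in> {1..M} \<Longrightarrow> y i \<in> B i"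
    and X_nonempty: "X \<noteq> {}"
begin

abbreviation "Y \<equiv> y ` {1..M}"

section \<open>Bins, representatives and weighting measures\<close>

lemma bin_index_eq: "i \<in> {1..M} \<Longrightarrow> x \<in> B i \<Longrightarrow> bin_index B M x = i"
  unfolding bin_index_def using disjoint_family_onD[OF B_disj] by (intro the_equality) blast+

lemma bin_eq: "i \<in> {1..M} \<Longrightarrow> x \<in> B i \<Longrightarrow> bin B M x = B i"
  by (simp add: bin_def bin_index_eq)

lemma quantize_eq: "i \<in> {1..M} \<Longrightarrow> x \<in> B i \<Longrightarrow> quantize B M y x = y i"
  by (simp add: quantize_def bin_index_eq)

lemma bin_cases:
  assumes "x \<in> X" obtains i where "i \<in> {1..M}" "x \<in> B i"
  using assms B_cover by blast

lemma y_in: "v \<in> Y \<Longrightarrow> v \<in> X"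
  using y_repr B_cover by blast

lemma quantize_in: "x \<in> X \<Longrightarrow> quantize B M y x \<in> Y"
  by (metis bin_cases quantize_eq imageI)

lemma inj_y: "inj_on y {1..M}"
  by (rule inj_onI) (metis bin_index_eq y_repr)

lemma Y_nonempty: "Y \<noteq> {}"
  using X_nonempty quantize_in by blast

text \<open>A point and its representative share a bin. Hence the equation of the finite model can
  be read at every state.\<close>

lemma bin_weight_quantize: "x \<in> X \<Longrightarrow> bin_weight B M \<pi> (quantize B M y x) = bin_weight B M \<pi> x"
  by (metis bin_weight_def bin_cases quantize_eq bin_eq y_repr)

lemma sets_bin_weight: "sets (bin_weight B M \<pi> x) = sets (borel_on X)"
  by (simp add: bin_weight_def sets_\<pi>)

lemma space_bin_weight: "space (bin_weight B M \<pi> x) = X"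
  using sets_eq_imp_space_eq[OF sets_bin_weight] by simp

lemma measurable_bin_weight: "g \<in> borel_measurable (borel_on X) \<Longrightarrow> g \<in> borel_measurable (bin_weight B M \<pi> x)"
  by (simp add: measurable_cong_sets[OF sets_bin_weight refl])

lemma prob_space_bin_weight:
  assumes "x \<in> X" shows "prob_space (bin_weight B M \<pi> x)"
proof -
  interpret prob_space \<pi> by (rule prob_space_\<pi>)
  from assms obtain i where "i \<in> {1..M}" "x \<in> B i" by (rule bin_cases)
  then show ?thesis
    using \<pi>_pos[of i] unfolding bin_weight_def
    by (intro prob_space_uniform_measure) (simp_all add: bin_eq emeasure_eq_measure)
qed

text \<open>Exhibits a quantized function as a simple function, for measurability and for
  integration against \<open>T\<close>.\<close>

lemma quantized_eq_sum:
  fixes J :: "'x \<Rightarrow> real"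
  assumes "x \<in> X"
  shows "J (quantize B M y x) = (\<Sum>i\<in>{1..M}. J (y i) * indicator (B i) x)"
proof -
  from assms obtain j where j: "j \<in> {1..M}" "x \<in> B j" by (rule bin_cases)
  have "(\<Sum>i\<in>{1..M}. J (y i) * indicator (B i) x) = (\<Sum>i\<in>{1..M}. if i = j then J (y i) else 0)"
    using j bin_index_eq by (intro sum.cong refl) (auto simp: indicator_def)
  then show ?thesis using j by (simp add: quantize_eq)
qed

lemma quantized_measurable:
  fixes J :: "'x \<Rightarrow> real"
  shows "(\<lambda>x. J (quantize B M y x)) \<in> borel_measurable (borel_on X)"
proof -
  have "(\<lambda>x. \<Sum>i\<in>{1..M}. J (y i) * indicator (B i) x) \<in> borel_measurable (borel_on X)"
    by (intro borel_measurable_sum borel_measurable_times borel_measurable_const borel_measurable_indicator B_meas)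
  then show ?thesis
    by (rule measurable_cong[THEN iffD1, rotated]) (simp add: quantized_eq_sum)
qed

lemma measure_T_measurable:
  "u \<in> U \<Longrightarrow> i \<in> {1..M} \<Longrightarrow> (\<lambda>x. measure (T (x, u)) (B i)) \<in> borel_measurable (borel_on X)"
  by (rule measurable_compose[OF measurable_prob_algebraD[OF T_section]
        measurable_measure_subprob_algebra[OF B_meas]])

lemma integrable_measure_T:
  assumes "v \<in> X" "u \<in> U" "i \<in> {1..M}"
  shows "integrable (bin_weight B M \<pi> v) (\<lambda>x. measure (T (x, u)) (B i))"
  by (rule prob_space.integrable_Icc[OF prob_space_bin_weight[OF assms(1)]
        measurable_bin_weight[OF measure_T_measurable[OF assms(2,3)]], of 0 1])
    (use assms in \<open>auto simp: space_bin_weight intro!: prob_space.prob_le_1 prob_space_T\<close>)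

text \<open>Integrating the simple function \<open>J (quantize B M y x')\<close> against
  \<open>T (x, u)\<close> gives a finite combination of bin probabilities; averaging it over the bin
  of \<open>v\<close> commutes with the finite sum.\<close>

lemma finite_kernel_sum:
  assumes v: "v \<in> Y" and u: "u \<in> U"
  shows "(\<Sum>z\<in>Y. J z * finite_kernel B M \<pi> T z v u) =
    (\<integral>x. (\<integral>x'. J (quantize B M y x') \<partial>T (x, u)) \<partial>bin_weight B M \<pi> v)"
proof -
  have "(\<Sum>z\<in>Y. J z * finite_kernel B M \<pi> T z v u) =
      (\<Sum>i\<in>{1..M}. J (y i) * (\<integral>x. measure (T (x, u)) (B i) \<partial>bin_weight B M \<pi> v))"
    \<comment> \<open>Representatives of disjoint bins are distinct, so the sum over
      \<open>Y\<close> may be indexed by bins.\<close>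
    using inj_y y_repr by (simp add: sum.reindex finite_kernel_def bin_eq)
  also have "\<dots> = (\<integral>x. (\<Sum>i\<in>{1..M}. J (y i) * measure (T (x, u)) (B i)) \<partial>bin_weight B M \<pi> v)"
    using integrable_measure_T[OF y_in[OF v] u] by (subst Bochner_Integration.integral_sum) auto
  also have "\<dots> = (\<integral>x. (\<integral>x'. J (quantize B M y x') \<partial>T (x, u)) \<partial>bin_weight B M \<pi> v)"
  proof (rule Bochner_Integration.integral_cong[OF refl])
    fix x assume "x \<in> space (bin_weight B M \<pi> v)"
    then have x: "x \<in> X" by (simp add: space_bin_weight)
    interpret prob_space "T (x, u)" by (rule prob_space_T[OF x u])
    have "integrable (T (x, u)) (indicat_real (B i))" if "i \<in> {1..M}" for i
      using B_meas[OF that] by (simp add: sets_T[OF x u] less_top[symmetric])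
    then have "(\<integral>x'. (\<Sum>i\<in>{1..M}. J (y i) * indicator (B i) x') \<partial>T (x, u)) =
        (\<Sum>i\<in>{1..M}. J (y i) * (\<integral>x'. indicat_real (B i) x' \<partial>T (x, u)))"
      by (subst Bochner_Integration.integral_sum) auto
    moreover have "B i \<inter> X = B i" if "i \<in> {1..M}" for i using that B_cover by blast
    ultimately have "(\<Sum>i\<in>{1..M}. J (y i) * measure (T (x, u)) (B i)) =
        (\<integral>x'. (\<Sum>i\<in>{1..M}. J (y i) * indicator (B i) x') \<partial>T (x, u))"
      by (simp add: space_T[OF x u])
    also have "\<dots> = (\<integral>x'. J (quantize B M y x') \<partial>T (x, u))"
      by (intro Bochner_Integration.integral_cong refl) (simp add: quantized_eq_sum space_T[OF x u])
    finally show "(\<Sum>i\<in>{1..M}. J (y i) * measure (T (x, u)) (B i)) = \<dots>" .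
  qed
  finally show ?thesis .
qed

lemma finite_kernel_nonneg: "0 \<le> finite_kernel B M \<pi> T z v u"
  by (simp add: finite_kernel_def)

text \<open>The case of the constant function 1 in \<open>finite_kernel_sum\<close>.\<close>

lemma finite_kernel_sum_1:
  assumes "v \<in> Y" "u \<in> U"
  shows "(\<Sum>z\<in>Y. finite_kernel B M \<pi> T z v u) = 1"
proof -
  have "(\<Sum>z\<in>Y. finite_kernel B M \<pi> T z v u) = (\<integral>x. (\<integral>x'. 1 \<partial>T (x, u)) \<partial>bin_weight B M \<pi> v)"
    using finite_kernel_sum[OF assms, of "\<lambda>_. 1"] by simp
  also have "\<dots> = (\<integral>x. 1 \<partial>bin_weight B M \<pi> v)"
    using assms by (intro Bochner_Integration.integral_cong refl)
      (simp add: space_bin_weight prob_space.prob_space[OF prob_space_T])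
  finally show ?thesis
    using assms by (simp add: prob_space.prob_space prob_space_bin_weight y_in)
qed

lemma finite_kernel_sum_le:
  assumes "v \<in> Y" "u \<in> U" "\<And>z. z \<in> Y \<Longrightarrow> J z \<le> b"
  shows "(\<Sum>z\<in>Y. J z * finite_kernel B M \<pi> T z v u) \<le> b"
proof -
  have "(\<Sum>z\<in>Y. J z * finite_kernel B M \<pi> T z v u) \<le> (\<Sum>z\<in>Y. b * finite_kernel B M \<pi> T z v u)"
    using assms by (intro sum_mono mult_right_mono finite_kernel_nonneg)
  then show ?thesis
    using finite_kernel_sum_1[OF assms(1,2)] by (simp flip: sum_distrib_left)
qed

section \<open>The Bellman operator of the finite model\<close>

definition "finite_bellman J v =
  (INF u\<in>U. finite_cost B M \<pi> c v u + \<beta> * (\<Sum>z\<in>Y. J z * finite_kernel B M \<pi> T z v u))"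

text \<open>Each row of the finite kernel is a probability vector, so averaging a difference bounded
  by \<open>e\<close> keeps the bound. The one-sided estimate is applied to both signs.\<close>

lemma finite_bellman_contraction:
  assumes e: "\<And>z. z \<in> Y \<Longrightarrow> \<bar>J z - J' z\<bar> \<le> e" and v: "v \<in> Y"
  shows "\<bar>finite_bellman J v - finite_bellman J' v\<bar> \<le> \<beta> * e"
  unfolding finite_bellman_def
proof (rule abs_INF_diff_le[OF U_finite U_nonempty])
  fix u assume u: "u \<in> U"
  let ?S = "\<lambda>J. \<Sum>z\<in>Y. J z * finite_kernel B M \<pi> T z v u"
  have "?S J - ?S J' \<le> e" "?S J' - ?S J \<le> e"
    using finite_kernel_sum_le[OF v u, of "\<lambda>z. J z - J' z" e] finite_kernel_sum_le[OF v u, of "\<lambda>z. J' z - J z" e] e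
    by (fastforce simp: left_diff_distrib sum_subtractf abs_le_iff)+
  then have "\<bar>\<beta> * (?S J - ?S J')\<bar> \<le> \<beta> * e"
    using beta by (simp add: abs_mult)
  then show "\<bar>finite_cost B M \<pi> c v u + \<beta> * ?S J - (finite_cost B M \<pi> c v u + \<beta> * ?S J')\<bar> \<le> \<beta> * e"
    by (simp add: algebra_simps)
qed

lemma finite_cost_Icc:
  assumes "v \<in> Y" "u \<in> U"
  shows "0 \<le> finite_cost B M \<pi> c v u" "finite_cost B M \<pi> c v u \<le> C"
  using prob_space.integral_Icc[OF prob_space_bin_weight[OF y_in[OF assms(1)]]
      measurable_bin_weight[OF c_section[OF assms(2)]], of 0 C]
  by (auto simp: finite_cost_def space_bin_weight c_nonneg c_le assms)

lemma finite_bellman_Icc: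
  assumes J: "\<And>z. z \<in> Y \<Longrightarrow> 0 \<le> J z" "\<And>z. z \<in> Y \<Longrightarrow> J z \<le> R" and v: "v \<in> Y"
  shows "0 \<le> finite_bellman J v" "finite_bellman J v \<le> R"
proof -
  let ?q = "\<lambda>u. finite_cost B M \<pi> c v u + \<beta> * (\<Sum>z\<in>Y. J z * finite_kernel B M \<pi> T z v u)"
  show "0 \<le> finite_bellman J v"
    unfolding finite_bellman_def using beta J
    by (intro cINF_greatest[OF U_nonempty] add_nonneg_nonneg mult_nonneg_nonneg sum_nonneg
        finite_cost_Icc finite_kernel_nonneg v) auto
  obtain u where u: "u \<in> U" using U_nonempty by auto
  have "finite_bellman J v \<le> ?q u"
    unfolding finite_bellman_def using u U_finite by (intro cINF_lower) auto
  also have "\<dots> \<le> C + \<beta> * R"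
    using beta by (intro add_mono mult_left_mono finite_cost_Icc finite_kernel_sum_le v u J) auto
  finally show "finite_bellman J v \<le> R" by (simp add: R_eq)
qed

text \<open>The \<open>THE\<close> in \<open>finite_value\<close> ranges over all real solutions,
  not just those between 0 and \<open>R\<close>, so uniqueness is shown for arbitrary ones.
  Finiteness of \<open>Y\<close> provides a largest difference \<open>e\<close>, and
  \<open>e \<le> \<beta> * e\<close> forces it to vanish.\<close>

lemma finite_bellman_unique:
  assumes "\<And>v. v \<in> Y \<Longrightarrow> J v = finite_bellman J v" "\<And>v. v \<in> Y \<Longrightarrow> J' v = finite_bellman J' v" "v \<in> Y"
  shows "J v = J' v"
proof -
  define e where "e = Max ((\<lambda>z. \<bar>J z - J' z\<bar>) ` Y)"
  have e: "\<bar>J z - J' z\<bar> \<le> e" if "z \<in> Y" for z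
    unfolding e_def using that by (intro Max_ge) auto
  have "e \<in> (\<lambda>z. \<bar>J z - J' z\<bar>) ` Y"
    unfolding e_def using Y_nonempty by (intro Max_in) auto
  then obtain z where "z \<in> Y" "e = \<bar>J z - J' z\<bar>" by blast
  then have "e \<le> \<beta> * e"
    using finite_bellman_contraction[OF e \<open>z \<in> Y\<close>] assms(1,2)[of z] by simp
  then have "e * (1 - \<beta>) \<le> 0" by (simp add: algebra_simps)
  then have "e \<le> 0" using beta by (simp add: mult_le_0_iff)
  then show ?thesis using e[OF assms(3)] by simp
qed

lemma finite_value:
  assumes "v \<in> Y"
  shows finite_value_eq: "finite_value B M y \<pi> U T c \<beta> v = finite_bellman (finite_value B M y \<pi> U T c \<beta>) v"
    and finite_value_Icc: "0 \<le> finite_value B M y \<pi> U T c \<beta> v" "finite_value B M y \<pi> U T c \<beta> v \<le> R"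
proof -
  obtain J where J: "\<forall>v\<in>Y. 0 \<le> J v \<and> J v \<le> R" "\<And>v. v \<in> Y \<Longrightarrow> J v = finite_bellman J v"
  proof (rule contraction_fixpoint[where Q="\<lambda>J. \<forall>v\<in>Y. 0 \<le> J v \<and> J v \<le> R" and S=Y and v\<^sub>0="\<lambda>_. 0"
        and R=R and \<beta>=\<beta> and F=finite_bellman])
    show "\<forall>v\<in>Y. 0 \<le> W v \<and> W v \<le> R"
      if V: "\<And>n. \<forall>v\<in>Y. 0 \<le> V n v \<and> V n v \<le> R" and lim: "\<And>x. x \<in> Y \<Longrightarrow> (\<lambda>n. V n x) \<longlonglongrightarrow> W x" for V W
    proof (intro ballI conjI)
      fix v assume v: "v \<in> Y"
      then have "0 \<le> V n v" "V n v \<le> R" for n using V by auto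
      then show "0 \<le> W v" "W v \<le> R"
        using LIMSEQ_le_const[OF lim[OF v]] LIMSEQ_le_const2[OF lim[OF v]] by blast+
    qed
    show "\<bar>finite_bellman v x - finite_bellman w x\<bar> \<le> \<beta> * e"
      if "\<And>x. x \<in> Y \<Longrightarrow> \<bar>v x - w x\<bar> \<le> e" "x \<in> Y" for v w e x
      using that by (rule finite_bellman_contraction)
    show "\<forall>v\<in>Y. 0 \<le> finite_bellman J v \<and> finite_bellman J v \<le> R"
      if "\<forall>v\<in>Y. 0 \<le> J v \<and> J v \<le> R" for J
      using that finite_bellman_Icc[of J] by blast
  qed (use beta R_nonneg in auto)
  \<comment> \<open>The operator reads its argument on \<open>Y\<close> only, so the fixed point may
    be made extensional.\<close>
  have "(\<Sum>z\<in>Y. restrict J Y z * k z) = (\<Sum>z\<in>Y. J z * k z)" for k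
    by (intro sum.cong) auto
  then have cong: "finite_bellman (restrict J Y) = finite_bellman J"
    by (simp only: finite_bellman_def[abs_def])
  have "finite_value B M y \<pi> U T c \<beta> = restrict J Y"
    unfolding finite_value_def finite_bellman_def[symmetric]
  proof (rule the_equality)
    show "restrict J Y \<in> extensional Y \<and> (\<forall>v\<in>Y. restrict J Y v = finite_bellman (restrict J Y) v)"
      unfolding cong by (metis J(2) restrict_apply' restrict_extensional)
    fix J' assume J': "J' \<in> extensional Y \<and> (\<forall>v\<in>Y. J' v = finite_bellman J' v)"
    show "J' = restrict J Y"
    proof (rule extensionalityI[of _ Y])
      fix v assume v: "v \<in> Y"
      then show "J' v = restrict J Y v"
        using J' finite_bellman_unique[OF _ J(2) v, of J'] by (metis restrict_apply')
    qed (use J' in simp_all)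
  qed
  then show "finite_value B M y \<pi> U T c \<beta> v = finite_bellman (finite_value B M y \<pi> U T c \<beta>) v"
    "0 \<le> finite_value B M y \<pi> U T c \<beta> v" "finite_value B M y \<pi> U T c \<beta> v \<le> R"
    using J assms by (metis cong restrict_apply')+
qed

section \<open>The finite value as a function on the state space\<close>

abbreviation "Jhat \<equiv> finite_value_ext B M y \<pi> U T c \<beta>"

lemma value_function_Jhat: "value_function Jhat"
  unfolding value_function_def finite_value_ext_def
  using quantized_measurable finite_value_Icc quantize_in by blast

lemma integrable_integral_T:
  assumes v: "value_function v" and x: "x \<in> X" and u: "u \<in> U"
  shows "integrable (bin_weight B M \<pi> x) (\<lambda>x'. \<integral>z. v z \<partial>T (x', u))"
  using v u integral_T_Icc[OF v _ u]
  by (intro prob_space.integrable_Icc[OF prob_space_bin_weight[OF x]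
        measurable_bin_weight[OF integral_T_measurable], of _ _ 0 R])
    (auto simp: space_bin_weight value_function_def)

lemma integrable_c:
  assumes x: "x \<in> X" and u: "u \<in> U"
  shows "integrable (bin_weight B M \<pi> x) (\<lambda>x'. c (x', u))"
  using u by (intro prob_space.integrable_Icc[OF prob_space_bin_weight[OF x]
        measurable_bin_weight[OF c_section], of _ 0 C]) (auto simp: space_bin_weight c_nonneg c_le)

text \<open>Rewrites the finite equation with the original cost and kernel, so that it can be
  compared with the Bellman equation of \<open>V\<close> action by action.\<close>

lemma Jhat_eq:
  assumes x: "x \<in> X"
  shows "Jhat x = (INF u\<in>U. \<integral>x'. c (x', u) + \<beta> * (\<integral>z. Jhat z \<partial>T (x', u)) \<partial>bin_weight B M \<pi> x)"
proof -
  let ?v = "quantize B M y x"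
  have "Jhat x = (INF u\<in>U. finite_cost B M \<pi> c ?v u
      + \<beta> * (\<integral>x'. (\<integral>z. Jhat z \<partial>T (x', u)) \<partial>bin_weight B M \<pi> ?v))"
    using finite_kernel_sum[OF quantize_in[OF x]]
    by (simp add: finite_value_ext_def finite_value_eq[OF quantize_in[OF x]] finite_bellman_def cong: INF_cong)
  also have "\<dots> = (INF u\<in>U. \<integral>x'. c (x', u) + \<beta> * (\<integral>z. Jhat z \<partial>T (x', u)) \<partial>bin_weight B M \<pi> x)"
    unfolding finite_cost_def bin_weight_quantize[OF x]
    using integrable_c[OF x] integrable_integral_T[OF value_function_Jhat x]
    by (intro INF_cong refl) simp
  finally show ?thesis .
qed

end

section \<open>The error bound\<close>

text \<open>For \<open>b\<close> positive, \<open>g / b\<close> is a competitor in the supremum that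
  defines \<open>tv_dist\<close>.\<close>

lemma abs_integral_diff_le_tv_dist:
  assumes \<mu>: "prob_space \<mu>" and \<nu>: "prob_space \<nu>" and sets: "sets \<nu> = sets \<mu>"
    and g: "g \<in> borel_measurable \<mu>" "\<And>x. x \<in> space \<mu> \<Longrightarrow> \<bar>g x\<bar> \<le> b" and b: "0 \<le> b"
  shows "\<bar>(\<integral>x. g x \<partial>\<mu>) - (\<integral>x. g x \<partial>\<nu>)\<bar> \<le> b * tv_dist \<mu> \<nu>"
proof (cases "b = 0")
  case True
  then have "(\<integral>x. g x \<partial>\<mu>) = (\<integral>x. 0 \<partial>\<mu>)" "(\<integral>x. g x \<partial>\<nu>) = (\<integral>x. 0 \<partial>\<nu>)"
    using g sets_eq_imp_space_eq[OF sets] by (auto intro!: integral_eq_zero_AE AE_I2)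
  then show ?thesis using True by simp
next
  case False
  let ?F = "{f \<in> borel_measurable \<mu>. \<forall>x\<in>space \<mu>. \<bar>f x\<bar> \<le> (1::real)}"
  let ?d = "\<lambda>f. \<bar>(\<integral>x. f x \<partial>\<mu>) - (\<integral>x. f x \<partial>\<nu>)\<bar>"
  \<comment> \<open>Both integrals lie between -1 and 1; the bound makes the real supremum genuine,
    as \<open>cSUP_upper\<close> demands.\<close>
  have "?d f \<le> 2" if "f \<in> ?F" for f
  proof -
    have "f \<in> borel_measurable \<mu>" "f \<in> borel_measurable \<nu>"
      "\<And>x. x \<in> space \<mu> \<Longrightarrow> -1 \<le> f x \<and> f x \<le> 1"  "\<And>x. x \<in> space \<nu> \<Longrightarrow> -1 \<le> f x \<and> f x \<le> 1"
      using that sets_eq_imp_space_eq[OF sets] by (auto simp: abs_le_iff measurable_cong_sets[OF sets refl])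
    then show ?thesis
      using prob_space.integral_Icc[OF \<mu>, of f "-1" 1] prob_space.integral_Icc[OF \<nu>, of f "-1" 1] by simp
  qed
  then have bdd: "bdd_above (?d ` ?F)" by (rule bdd_aboveI2)
  have "(\<lambda>x. g x / b) \<in> ?F" using g b False by auto
  from cSUP_upper[OF this bdd] have "?d (\<lambda>x. g x / b) \<le> tv_dist \<mu> \<nu>" by (simp add: tv_dist_def)
  moreover have "?d (\<lambda>x. g x / b) = ?d g / b"
    using b by (simp flip: diff_divide_distrib)
  ultimately show ?thesis using b False by (simp add: field_simps)
qed

lemma l1_norm_nonneg: "0 \<le> l1_norm x"
  by (simp add: l1_norm_def sum_nonneg)

lemma borel_measurable_l1_norm [measurable]: "l1_norm \<in> borel_measurable borel"
  unfolding l1_norm_def[abs_def] by (intro borel_measurable_continuous_onI continuous_intros)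

lemma l1_norm_minus_commute: "l1_norm (x - y) = l1_norm (y - x)"
  by (simp add: l1_norm_def abs_minus_commute)

locale lipschitz_quantized_mdp = quantized_mdp X U T c \<beta> C B M y \<pi>
  for X :: "(real ^ 'n) set" and U :: "'u::t1_space set" and T c \<beta> C B M y \<pi> +
  fixes \<alpha>\<^sub>c \<alpha>\<^sub>T :: real
  assumes alpha_pos: "0 < \<alpha>\<^sub>c" "0 < \<alpha>\<^sub>T"
    and c_lipschitz: "\<And>x x' u. x \<in> X \<Longrightarrow> x' \<in> X \<Longrightarrow> u \<in> U \<Longrightarrow>
      \<bar>c (x, u) - c (x', u)\<bar> \<le> \<alpha>\<^sub>c * l1_norm (x - x')"
    and T_lipschitz: "\<And>x x' u. x \<in> X \<Longrightarrow> x' \<in> X \<Longrightarrow> u \<in> U \<Longrightarrow>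
      tv_dist (T (x, u)) (T (x', u)) \<le> \<alpha>\<^sub>T * l1_norm (x - x')"
begin

abbreviation "L \<equiv> quant_loss B M \<pi>"

text \<open>One term for moving the cost, one for moving the kernel under a function bounded by
  \<open>R\<close>. With \<open>C\<close> the sup norm of \<open>c\<close> this is the constant of
  the theorem.\<close>

definition "error_factor = \<alpha>\<^sub>c + \<beta> * (\<alpha>\<^sub>T * R)"

lemma error_factor_pos: "0 < error_factor"
  using alpha_pos beta R_nonneg by (simp add: error_factor_def add_pos_nonneg)

lemma l1_norm_diff_measurable: "(\<lambda>z. ennreal (l1_norm (fst z - snd z))) \<in> borel_measurable (borel_on X \<Otimes>\<^sub>M borel_on X)"
proof -
  have id: "(\<lambda>x. x) \<in> borel_on X \<rightarrow>\<^sub>M borel"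
    by (rule measurable_restrict_space1) simp
  have [measurable]: "fst \<in> borel_on X \<Otimes>\<^sub>M borel_on X \<rightarrow>\<^sub>M borel" "snd \<in> borel_on X \<Otimes>\<^sub>M borel_on X \<rightarrow>\<^sub>M borel"
    by (rule measurable_compose[OF measurable_fst id], rule measurable_compose[OF measurable_snd id])
  show ?thesis by measurable
qed

text \<open>The weighting measure depends on \<open>x\<close> only through its bin, so
  \<open>L\<close> is a finite sum of integrals against fixed measures, cut off by bin
  indicators.\<close>

lemma L_measurable: "L \<in> borel_measurable (borel_on X)"
proof -
  have "(\<lambda>x. \<Sum>i\<in>{1..M}. (\<integral>\<^sup>+x'. ennreal (l1_norm (x - x')) \<partial>bin_weight B M \<pi> (y i)) * indicator (B i) x)
    \<in> borel_measurable (borel_on X)"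
  proof (intro borel_measurable_sum borel_measurable_times_ennreal borel_measurable_indicator B_meas)
    fix i assume i: "i \<in> {1..M}"
    then interpret prob_space "bin_weight B M \<pi> (y i)"
      using prob_space_bin_weight y_in by blast
    show "(\<lambda>x. \<integral>\<^sup>+x'. ennreal (l1_norm (x - x')) \<partial>bin_weight B M \<pi> (y i)) \<in> borel_measurable (borel_on X)"
      by (rule borel_measurable_nn_integral)
        (use l1_norm_diff_measurable in \<open>simp add: split_beta' measurable_cong_sets[OF sets_pair_measure_cong[OF refl sets_bin_weight] refl]\<close>)
  qed
  then show ?thesis
  proof (rule measurable_cong[THEN iffD1, rotated])
    fix x assume "x \<in> space (borel_on X)"
    then obtain j where j: "j \<in> {1..M}" "x \<in> B j" using bin_cases by auto
    let ?I = "\<lambda>i. \<integral>\<^sup>+x'. ennreal (l1_norm (x - x')) \<partial>bin_weight B M \<pi> (y i)"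
    have "(\<Sum>i\<in>{1..M}. ?I i * indicator (B i) x) = (\<Sum>i\<in>{1..M}. if i = j then ?I i else 0)"
      using j bin_index_eq by (intro sum.cong refl) (auto simp: indicator_def)
    also have "\<dots> = ?I j" using j by simp
    also have "bin_weight B M \<pi> (y j) = bin_weight B M \<pi> x"
      using j by (simp add: bin_weight_def bin_eq y_repr)
    finally show "(\<Sum>i\<in>{1..M}. ?I i * indicator (B i) x) = L x" by (simp add: quant_loss_def)
  qed
qed

text \<open>Only boundedness and measurability of \<open>v\<close> enter, which makes the estimate
  applicable to the step function \<open>Jhat\<close>.\<close>

lemma one_stage_lipschitz:
  assumes v: "value_function v" and x: "x \<in> X" and x': "x' \<in> X" and u: "u \<in> U"
  shows "\<bar>(c (x', u) + \<beta> * (\<integral>z. v z \<partial>T (x', u))) - (c (x, u) + \<beta> * (\<integral>z. v z \<partial>T (x, u)))\<bar> \<le> error_factor * l1_norm (x - x')"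
proof -
  have "\<bar>(\<integral>z. v z \<partial>T (x', u)) - (\<integral>z. v z \<partial>T (x, u))\<bar> \<le> R * tv_dist (T (x', u)) (T (x, u))"
    using v x x' u by (intro abs_integral_diff_le_tv_dist prob_space_T measurable_T R_nonneg)
      (auto simp: value_function_def sets_T space_T)
  also have "\<dots> \<le> R * (\<alpha>\<^sub>T * l1_norm (x' - x))"
    by (intro mult_left_mono T_lipschitz x x' u R_nonneg)
  finally have "\<beta> * \<bar>(\<integral>z. v z \<partial>T (x', u)) - (\<integral>z. v z \<partial>T (x, u))\<bar> \<le> \<beta> * (R * (\<alpha>\<^sub>T * l1_norm (x - x')))"
    using beta by (simp add: l1_norm_minus_commute)
  then have "\<bar>\<beta> * (\<integral>z. v z \<partial>T (x', u)) - \<beta> * (\<integral>z. v z \<partial>T (x, u))\<bar> \<le> \<beta> * (R * (\<alpha>\<^sub>T * l1_norm (x - x')))"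
    using beta by (simp add: abs_mult flip: right_diff_distrib)
  moreover have "\<bar>c (x', u) - c (x, u)\<bar> \<le> \<alpha>\<^sub>c * l1_norm (x - x')"
    using c_lipschitz[OF x' x u] by (simp add: l1_norm_minus_commute)
  moreover have "error_factor * l1_norm (x - x') = \<alpha>\<^sub>c * l1_norm (x - x') + \<beta> * (R * (\<alpha>\<^sub>T * l1_norm (x - x')))"
    by (simp add: error_factor_def algebra_simps)
  ultimately show ?thesis by linarith
qed

text \<open>For a fixed action there are two moves: from \<open>x'\<close> to \<open>x\<close> with
  \<open>Jhat\<close> kept, paid by \<open>L x\<close>, and then from \<open>Jhat\<close> to
  \<open>V\<close> at \<open>x\<close>, paid by \<open>\<beta> * m\<close>. Passing to the infima is
  possible because \<open>m\<close> dominates every action.\<close>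

lemma one_step_error:
  assumes V: "value_function V"
    and bellman: "\<And>x. x \<in> X \<Longrightarrow> V x = (INF u\<in>U. c (x, u) + \<beta> * (\<integral>x'. V x' \<partial>T (x, u)))"
    and x: "x \<in> X"
    and m: "\<And>u. u \<in> U \<Longrightarrow> (\<integral>x'. \<bar>Jhat x' - V x'\<bar> \<partial>T (x, u)) \<le> m"
  shows "ennreal \<bar>Jhat x - V x\<bar> \<le> ennreal error_factor * L x + ennreal \<beta> * ennreal m"
\<comment> \<open>An infinite loss makes the right-hand side infinite, as the factor is positive;
  otherwise all terms are real.\<close>
proof (cases "L x = \<infinity>")
  case True
  then show ?thesis using error_factor_pos by (simp add: ennreal_mult_top)
next
  case False
  let ?w = "bin_weight B M \<pi> x"
  interpret prob_space ?w by (rule prob_space_bin_weight[OF x])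
  have l1_meas: "(\<lambda>x'. l1_norm (x - x')) \<in> borel_measurable ?w"
  proof (rule measurable_bin_weight, rule measurable_restrict_space1)
    show "(\<lambda>x'. l1_norm (x - x')) \<in> borel_measurable borel" by measurable
  qed
  have l1_int: "integrable ?w (\<lambda>x'. l1_norm (x - x'))"
    using False l1_meas by (intro integrableI_nonneg) (auto simp: l1_norm_nonneg quant_loss_def top.not_eq_extremum)
  have L_eq: "L x = ennreal (\<integral>x'. l1_norm (x - x') \<partial>?w)"
    unfolding quant_loss_def by (intro nn_integral_eq_integral l1_int AE_I2 l1_norm_nonneg)
  have m_nonneg: "0 \<le> m"
  proof -
    obtain u where u: "u \<in> U" using U_nonempty by auto
    have "0 \<le> (\<integral>x'. \<bar>Jhat x' - V x'\<bar> \<partial>T (x, u))" by simp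
    also have "\<dots> \<le> m" by (rule m[OF u])
    finally show ?thesis .
  qed
  have "\<bar>Jhat x - V x\<bar> \<le> error_factor * (\<integral>x'. l1_norm (x - x') \<partial>?w) + \<beta> * m"
    unfolding Jhat_eq[OF x] bellman[OF x]
  proof (rule abs_INF_diff_le[OF U_finite U_nonempty])
    fix u assume u: "u \<in> U"
    let ?G = "\<lambda>x'. c (x', u) + \<beta> * (\<integral>z. Jhat z \<partial>T (x', u))"
    have G_int: "integrable ?w ?G"
      using integrable_c[OF x u] integrable_integral_T[OF value_function_Jhat x u] by simp
    \<comment> \<open>\<open>?G x\<close> is its own mean under the probability measure
      \<open>?w\<close>.\<close>
    have "\<bar>(\<integral>x'. ?G x' \<partial>?w) - ?G x\<bar> = \<bar>\<integral>x'. ?G x' - ?G x \<partial>?w\<bar>"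
      using G_int by (subst Bochner_Integration.integral_diff) (simp_all add: prob_space)
    also have "\<dots> \<le> (\<integral>x'. \<bar>?G x' - ?G x\<bar> \<partial>?w)"
      by (rule integral_abs_bound)
    also have "\<dots> \<le> (\<integral>x'. error_factor * l1_norm (x - x') \<partial>?w)"
    proof (rule integral_mono)
      show "integrable ?w (\<lambda>x'. \<bar>?G x' - ?G x\<bar>)"
        by (intro integrable_abs Bochner_Integration.integrable_diff G_int integrable_const)
      show "integrable ?w (\<lambda>x'. error_factor * l1_norm (x - x'))" using l1_int by simp
      show "\<bar>?G x' - ?G x\<bar> \<le> error_factor * l1_norm (x - x')" if "x' \<in> space ?w" for x'
        using one_stage_lipschitz[OF value_function_Jhat x _ u] that by (simp add: space_bin_weight)
    qed
    finally have 1: "\<bar>(\<integral>x'. ?G x' \<partial>?w) - ?G x\<bar> \<le> error_factor * (\<integral>x'. l1_norm (x - x') \<partial>?w)" by simp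
    have "\<bar>(\<integral>z. Jhat z \<partial>T (x, u)) - (\<integral>z. V z \<partial>T (x, u))\<bar> = \<bar>\<integral>z. Jhat z - V z \<partial>T (x, u)\<bar>"
      using integrable_T[OF value_function_Jhat x u] integrable_T[OF V x u] by simp
    also have "\<dots> \<le> (\<integral>z. \<bar>Jhat z - V z\<bar> \<partial>T (x, u))" by (rule integral_abs_bound)
    also have "\<dots> \<le> m" by (rule m[OF u])
    finally have "\<bar>\<beta> * ((\<integral>z. Jhat z \<partial>T (x, u)) - (\<integral>z. V z \<partial>T (x, u)))\<bar> \<le> \<beta> * m"
      using beta by (simp add: abs_mult)
    then have 2: "\<bar>?G x - (c (x, u) + \<beta> * (\<integral>z. V z \<partial>T (x, u)))\<bar> \<le> \<beta> * m"
      by (simp add: algebra_simps)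
    from 1 2 show "\<bar>(\<integral>x'. ?G x' \<partial>?w) - (c (x, u) + \<beta> * (\<integral>z. V z \<partial>T (x, u)))\<bar>
        \<le> error_factor * (\<integral>x'. l1_norm (x - x') \<partial>?w) + \<beta> * m" by linarith
  qed
  moreover have "0 \<le> (\<integral>x'. l1_norm (x - x') \<partial>?w)" by (simp add: l1_norm_nonneg)
  ultimately show ?thesis
    using error_factor_pos beta m_nonneg by (simp add: L_eq ennreal_leI flip: ennreal_mult ennreal_plus)
qed

abbreviation "Jopt \<equiv> optimal_cost X U T c \<beta>"

text \<open>\<open>Jopt\<close> is replaced by the fixed point \<open>V\<close>, which is known to
  be measurable and bounded.\<close>

lemma error_bound:
  assumes x0: "x\<^sub>0 \<in> X"
  shows error_maximizing_ex: "\<exists>f. error_maximizing X U T Jhat Jopt f"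
    and error_maximizing_bound: "error_maximizing X U T Jhat Jopt f \<Longrightarrow>
      ennreal \<bar>Jhat x\<^sub>0 - Jopt x\<^sub>0\<bar> \<le> ennreal error_factor * expected_discounted X U T L \<beta> x\<^sub>0 (stationary f)"
proof -
  obtain V where V: "value_function V"
    and bellman: "\<And>x. x \<in> X \<Longrightarrow> V x = (INF u\<in>U. c (x, u) + \<beta> * (\<integral>x'. V x' \<partial>T (x, u)))"
    by (rule bellman_fixpoint) (rule that)
  have Jopt: "Jopt x = V x" if "x \<in> X" for x
    by (rule optimal_cost_eq[OF V bellman that])
  let ?D = "\<lambda>x. \<bar>Jhat x - V x\<bar>"
  let ?I = "\<lambda>x u. \<integral>x'. ?D x' \<partial>T (x, u)"
  have D_meas: "?D \<in> borel_measurable (borel_on X)"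
    using V value_function_Jhat by (auto simp: value_function_def)
  have D_le: "?D x \<le> R" if "x \<in> X" for x
    using V value_function_Jhat that by (fastforce simp: value_function_def abs_le_iff)
  \<comment> \<open>\<open>T (x, u)\<close> lives on \<open>X\<close>, where \<open>Jopt\<close> and
    \<open>V\<close> agree; elsewhere nothing is known about \<open>Jopt\<close>.\<close>
  have I_eq: "(\<integral>x'. \<bar>Jhat x' - Jopt x'\<bar> \<partial>T (x, u)) = ?I x u" if "x \<in> X" "u \<in> U" for x u
    using that by (intro Bochner_Integration.integral_cong refl) (simp add: space_T Jopt)
  have maximizing_iff: "error_maximizing X U T Jhat Jopt f \<longleftrightarrow>
      f \<in> borel_on X \<rightarrow>\<^sub>M borel_on U \<and> (\<forall>x\<in>X. ?I x (f x) = (SUP u\<in>U. ?I x u))" for f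
  proof -
    have "f x \<in> U" if "f \<in> borel_on X \<rightarrow>\<^sub>M borel_on U" "x \<in> X" for x
      using measurable_space[OF that(1)] that(2) by simp
    then show ?thesis
      unfolding error_maximizing_def by (auto simp: I_eq cong: SUP_cong)
  qed
  show "\<exists>f. error_maximizing X U T Jhat Jopt f"
  proof -
    obtain f where "f \<in> borel_on X \<rightarrow>\<^sub>M count_space U" "\<And>x. x \<in> space (borel_on X) \<Longrightarrow> ?I x (f x) = (SUP u\<in>U. ?I x u)"
      using measurable_argmax_finite[OF U_finite U_nonempty, of ?I "borel_on X"] integral_T_measurable[OF D_meas]
      by blast
    then show ?thesis by (auto simp: maximizing_iff measurable_into_U)
  qed
  assume "error_maximizing X U T Jhat Jopt f"
  then have f: "f \<in> borel_on X \<rightarrow>\<^sub>M borel_on U" and max: "\<And>x. x \<in> X \<Longrightarrow> ?I x (f x) = (SUP u\<in>U. ?I x u)"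
    by (auto simp: maximizing_iff)
  have "ennreal (?D x\<^sub>0) \<le> ennreal error_factor * expected_discounted X U T L \<beta> x\<^sub>0 (stationary f)"
  proof (rule error_propagation[OF D_meas _ D_le f L_measurable _ x0])
    show "ennreal (?D x) \<le> ennreal error_factor * L x + ennreal \<beta> * ennreal (?I x (f x))" if x: "x \<in> X" for x
    proof (rule one_step_error[OF V bellman x])
      \<comment> \<open>The value at the maximizing action serves as the uniform bound
        \<open>m\<close>.\<close>
      show "?I x u \<le> ?I x (f x)" if "u \<in> U" for u
        unfolding max[OF x] using that U_finite by (intro cSUP_upper) auto
    qed
  qed simp
  then show "ennreal \<bar>Jhat x\<^sub>0 - Jopt x\<^sub>0\<bar> \<le> ennreal error_factor * expected_discounted X U T L \<beta> x\<^sub>0 (stationary f)"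
    by (simp add: Jopt[OF x0])
qed

end

theorem theorem2p2:
  fixes X :: "(real ^ 'n) set"
    and U :: "'u::metric_space set"
    and T :: "(real ^ 'n) \<times> 'u \<Rightarrow> (real ^ 'n) measure"
    and c :: "(real ^ 'n) \<times> 'u \<Rightarrow> real"
    and \<beta> \<alpha>\<^sub>c \<alpha>\<^sub>T :: real
    and B :: "nat \<Rightarrow> (real ^ 'n) set"
    and y :: "nat \<Rightarrow> real ^ 'n"
    and M :: nat
    and \<pi> :: "(real ^ 'n) measure"
    and x\<^sub>0 :: "real ^ 'n"
  assumes X_borel: "X \<in> sets borel"
    and U: "U \<noteq> {}" "compact U" "finite U"
    and T_kernel: "T \<in> borel_on X \<Otimes>\<^sub>M borel_on U \<rightarrow>\<^sub>M prob_algebra (borel_on X)"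
    and \<beta>: "0 < \<beta>" "\<beta> < 1"
    and c_nonneg: "\<And>x u. x \<in> X \<Longrightarrow> u \<in> U \<Longrightarrow> 0 \<le> c (x, u)"
    and c_bounded: "bounded (c ` (X \<times> U))"
    and c_cont: "continuous_on (X \<times> U) c"
    and T_feller: "weak_feller X U T"
    and \<alpha>_pos: "0 < \<alpha>\<^sub>c" "0 < \<alpha>\<^sub>T"
    and c_lipschitz: "\<And>x x' u. x \<in> X \<Longrightarrow> x' \<in> X \<Longrightarrow> u \<in> U \<Longrightarrow>
      \<bar>c (x, u) - c (x', u)\<bar> \<le> \<alpha>\<^sub>c * l1_norm (x - x')"
    and T_lipschitz: "\<And>x x' u. x \<in> X \<Longrightarrow> x' \<in> X \<Longrightarrow> u \<in> U \<Longrightarrow>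
      tv_dist (T (x, u)) (T (x', u)) \<le> \<alpha>\<^sub>T * l1_norm (x - x')"
    and B_meas: "\<And>i. i \<in> {1..M} \<Longrightarrow> B i \<in> sets (borel_on X)"
    and B_disj: "disjoint_family_on B {1..M}"
    and B_cover: "(\<Union>i\<in>{1..M}. B i) = X"
    and \<pi>_prob: "prob_space \<pi>" "sets \<pi> = sets (borel_on X)"
    and \<pi>_pos: "\<And>i. i \<in> {1..M} \<Longrightarrow> 0 < measure \<pi> (B i)"
    and y_repr: "\<And>i. i \<in> {1..M} \<Longrightarrow> y i \<in> B i"
    and x\<^sub>0: "x\<^sub>0 \<in> X"
  defines "Jhat \<equiv> finite_value_ext B M y \<pi> U T c \<beta>"
    and "Jopt \<equiv> optimal_cost X U T c \<beta>"
    and "L \<equiv> quant_loss B M \<pi>"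
    and "K \<equiv> \<alpha>\<^sub>c + \<beta> * \<alpha>\<^sub>T * sup_norm_on (X \<times> U) c / (1 - \<beta>)"
  shows "(\<exists>f. error_maximizing X U T Jhat Jopt f) \<and>
    (\<forall>f. error_maximizing X U T Jhat Jopt f \<longrightarrow>
      ennreal \<bar>Jhat x\<^sub>0 - Jopt x\<^sub>0\<bar>
        \<le> ennreal K * expected_discounted X U T L \<beta> x\<^sub>0 (stationary f)) \<and>
    ennreal \<bar>Jhat x\<^sub>0 - Jopt x\<^sub>0\<bar>
      \<le> ennreal K * (SUP f\<in>borel_on X \<rightarrow>\<^sub>M borel_on U.
          expected_discounted X U T L \<beta> x\<^sub>0 (stationary f))"
proof -
  define C where "C = sup_norm_on (X \<times> U) c"
  obtain b where b: "\<And>z. z \<in> X \<times> U \<Longrightarrow> \<bar>c z\<bar> \<le> b"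
    using c_bounded by (auto simp: bounded_iff)
  \<comment> \<open>Boundedness of \<open>c\<close> makes \<open>sup_norm_on\<close> a genuine
    supremum.\<close>
  have c_abs_le: "\<bar>c z\<bar> \<le> C" if "z \<in> X \<times> U" for z
    unfolding C_def sup_norm_on_def
    using b by (intro cSUP_upper[OF that] bdd_aboveI2)
  obtain u where u: "u \<in> U" using U(1) by auto
  interpret lipschitz_quantized_mdp X U T c \<beta> C B M y \<pi> \<alpha>\<^sub>c \<alpha>\<^sub>T
  proof (intro lipschitz_quantized_mdp.intro quantized_mdp.intro finite_action_mdp.intro
      quantized_mdp_axioms.intro lipschitz_quantized_mdp_axioms.intro)
    show "(\<lambda>x. c (x, u)) \<in> borel_measurable (borel_on X)" if "u \<in> U" for u
      using that by (intro borel_measurable_continuous_on_restrict continuous_on_compose2[OF c_cont])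
        (auto intro!: continuous_intros)
    show "c (x, u) \<le> C" if "x \<in> X" "u \<in> U" for x u
      using c_abs_le[of "(x, u)"] that by simp
    show "0 \<le> C" using c_abs_le[of "(x\<^sub>0, u)"] x\<^sub>0 u by simp
    show "X \<noteq> {}" using x\<^sub>0 by auto
  qed (fact U T_kernel \<beta> c_nonneg B_meas B_disj B_cover \<pi>_prob \<pi>_pos y_repr \<alpha>_pos c_lipschitz T_lipschitz)+
  have K: "K = error_factor"
    unfolding error_factor_def R_def by (simp add: K_def C_def)
  note bound = error_maximizing_bound[OF x\<^sub>0, folded K Jhat_def Jopt_def L_def]
  obtain f where f: "error_maximizing X U T Jhat Jopt f"
    using error_maximizing_ex[OF x\<^sub>0] unfolding Jhat_def Jopt_def by blast
  \<comment> \<open>A maximizing policy exists and is one of the stationary policies in the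
    supremum.\<close>
  have "ennreal \<bar>Jhat x\<^sub>0 - Jopt x\<^sub>0\<bar> \<le> ennreal K * expected_discounted X U T L \<beta> x\<^sub>0 (stationary f)"
    by (rule bound[OF f])
  also have "\<dots> \<le> ennreal K * (SUP f\<in>borel_on X \<rightarrow>\<^sub>M borel_on U. expected_discounted X U T L \<beta> x\<^sub>0 (stationary f))"
    using f by (intro mult_left_mono SUP_upper) (auto simp: error_maximizing_def)
  finally show ?thesis using f bound by blast
qed

end
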